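(* Let $X=\Sigma_{\boldsymbol a}\times G$, where $\Sigma_{\boldsymbol a}$ is the $\boldsymbol a$-adic solenoid with $\boldsymbol a=(2,3,4,\dots)$, and $G$ is a finite Abelian group containing no elements of order $2$. Let $\alpha$ be a topological automorphism of $X$; it has the form $\alpha(z,g)=(az,\alpha_G g)$ for $z\in\Sigma_{\boldsymbol a}$, $g\in G$, where $a$ is a nonzero rational number and $\alpha_G$ is an automorphism of $G$. Set $K=\mathrm{Ker}(I+\alpha_G)\subset G$. Let $\xi_1$ and $\xi_2$ be independent random variables with values in $X$ and distributions $\mu_1$ and $\mu_2$ whose characteristic functions do not vanish anywhere on the character group of $X$. Assume that the conditional distribution of the linear form $L_2=\xi_1+\alpha\xi_2$ given $L_1=\xi_1+\xi_2$ is symmetric. If $a\neq-1$, then $\mu_j=\gamma_j*\omega*E_{x_j}$, $j=1,2$, where $\gamma_j$ is a Gaussian distribution on $\Sigma_{\boldsymbol a}$ (regarded as the subgroup $\Sigma_{\boldsymbol a}\times\{0\}$), $\omega$ is a distribution supported in $K$, and $x_j\in X$. If $a=-1$, then $\mu_j=\omega*E_{x_j}$, $j=1,2$, where $\omega$ is a distribution supported in $\Sigma_{\boldsymbol a}\times K$ and $x_j\in X$.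
   Context: The $\boldsymbol a$-adic solenoid $\Sigma_{\boldsymbol a}$ with $\boldsymbol a=(2,3,4,\dots)$ is the compact connected one-dimensional Abelian group whose character group is the additive group $\mathbb{Q}$ of rationals with the discrete topology (equivalently, the Pontryagin dual of discrete $\mathbb{Q}$); it is torsion-free and uniquely divisible, so multiplication by a nonzero rational is a topological automorphism, and all its topological automorphisms are of this form. For a locally compact Abelian group $X$ with character group $Y$, the characteristic function of a probability distribution $\mu$ is $\hat\mu(y)=\int_X(x,y)\,d\mu(x)$, where $(x,y)$ is the value of the character $y$ at $x$. $E_x$ is the degenerate distribution at $x$ and $*$ is convolution. A Gaussian distribution on $\Sigma_{\boldsymbol a}$ is one whose characteristic function is $\hat\gamma(r)=(z,r)\exp\{-\sigma r^2\}$, $r\in\mathbb{Q}$, with $z\in\Sigma_{\boldsymbol a}$, $\sigma\ge0$. "The conditional distribution of $L_2$ given $L_1$ is symmetric" means that the random vectors $(L_1,L_2)$ and $(L_1,-L_2)$ have the same distribution. *)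

theory Defs
  imports "HOL-Probability.Probability"
begin

text \<open>The a-adic solenoid with a = (2,3,4,...) is the Pontryagin dual of the discrete
group of rationals.  We represent its points as the characters of the rationals,
i.e. homomorphisms from (rat,+) to the unit circle; the group operation on the solenoid
is pointwise multiplication, and the value of the character r at the point chi is chi r.\<close>

definition sol :: "(rat \<Rightarrow> complex) set" where
  "sol = {c. (\<forall>r. cmod (c r) = 1) \<and> (\<forall>r s. c (r + s) = c r * c s)}"

text \<open>Borel sigma algebra of the solenoid: the (countable) product topology
restricted to the solenoid is the compact topology, so Borel = restricted product.\<close>
definition sol_M :: "(rat \<Rightarrow> complex) measure" where
  "sol_M = restrict_space (PiM UNIV (\<lambda>_. borel)) sol"

definition X_M :: "((rat \<Rightarrow> complex) \<times> 'g) measure" where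
  "X_M = sol_M \<Otimes>\<^sub>M count_space UNIV"

definition xadd :: "((rat \<Rightarrow> complex) \<times> 'g::plus) \<Rightarrow> ((rat \<Rightarrow> complex) \<times> 'g) \<Rightarrow> ((rat \<Rightarrow> complex) \<times> 'g)" where
  "xadd x y = ((\<lambda>r. fst x r * fst y r), snd x + snd y)"

definition xneg :: "((rat \<Rightarrow> complex) \<times> 'g::uminus) \<Rightarrow> ((rat \<Rightarrow> complex) \<times> 'g)" where
  "xneg x = ((\<lambda>r. fst x (- r)), - snd x)"

text \<open>The automorphism (z,g) -> (a z, alpha_G g); multiplication by a on the solenoid
is dual to multiplication by a on the rationals.\<close>
definition alpha_aut :: "rat \<Rightarrow> ('g \<Rightarrow> 'g) \<Rightarrow> ((rat \<Rightarrow> complex) \<times> 'g) \<Rightarrow> ((rat \<Rightarrow> complex) \<times> 'g)" where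
  "alpha_aut a \<alpha>G x = ((\<lambda>r. fst x (a * r)), \<alpha>G (snd x))"

definition g_char :: "('g::plus \<Rightarrow> complex) \<Rightarrow> bool" where
  "g_char \<psi> \<longleftrightarrow> (\<forall>g. cmod (\<psi> g) = 1) \<and> (\<forall>g h. \<psi> (g + h) = \<psi> g * \<psi> h)"

definition charfun_X :: "((rat \<Rightarrow> complex) \<times> 'g) measure \<Rightarrow> rat \<Rightarrow> ('g \<Rightarrow> complex) \<Rightarrow> complex" where
  "charfun_X \<mu> r \<psi> = integral\<^sup>L \<mu> (\<lambda>x. fst x r * \<psi> (snd x))"

definition charfun_sol :: "(rat \<Rightarrow> complex) measure \<Rightarrow> rat \<Rightarrow> complex" where
  "charfun_sol \<gamma> r = integral\<^sup>L \<gamma> (\<lambda>c. c r)"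

definition gaussian_sol :: "(rat \<Rightarrow> complex) measure \<Rightarrow> bool" where
  "gaussian_sol \<gamma> \<longleftrightarrow> prob_space \<gamma> \<and> sets \<gamma> = sets sol_M \<and>
     (\<exists>z\<in>sol. \<exists>\<sigma>::real. \<sigma> \<ge> 0 \<and>
        (\<forall>r. charfun_sol \<gamma> r = z r * exp (complex_of_real (- \<sigma> * (real_of_rat r)\<^sup>2))))"

definition conv_X :: "((rat \<Rightarrow> complex) \<times> 'g::plus) measure \<Rightarrow> ((rat \<Rightarrow> complex) \<times> 'g) measure \<Rightarrow> ((rat \<Rightarrow> complex) \<times> 'g) measure" where
  "conv_X \<mu> \<nu> = distr (\<mu> \<Otimes>\<^sub>M \<nu>) X_M (\<lambda>(x, y). xadd x y)"

definition embed_sol :: "(rat \<Rightarrow> complex) measure \<Rightarrow> ((rat \<Rightarrow> complex) \<times> 'g::zero) measure" where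
  "embed_sol \<gamma> = distr \<gamma> X_M (\<lambda>c. (c, 0))"

end

theory Submission
  imports Defs
begin

text \<open>The symmetry assumption says that the characteristic functions satisfy Heyde's equation
  \<open>f1 (u + v) f2 (u + b v) = f1 (u - v) f2 (u - b v)\<close> on the character group \<open>rat \<times> H\<close>, where \<open>H\<close> is the
  dual of \<open>G\<close> and \<open>b\<close> is the adjoint of the automorphism. On the finite group \<open>H\<close>, summing logarithms of
  moduli over the images of the powers of \<open>I - b\<close> forces both moduli to be one on \<open>(I + b) H\<close>. There the
  distributions are degenerate, and after a shift \<open>f1\<close> and \<open>f2\<close> are invariant under \<open>(I + b) H\<close>, the
  annihilator of \<open>K\<close>. Modulo this subgroup \<open>b\<close> acts as \<open>-I\<close> and the equation separates the variables: for
  \<open>a = -1\<close> it says \<open>f1 = f2\<close>, and otherwise \<open>f_j (r, h) = f_j (r, 0) k h\<close> with a common factor \<open>k\<close>. On the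
  rationals the second differences of \<open>f_j\<close> are constant, which gives a character times a Gaussian.\<close>

section \<open>Characters of finite Abelian groups\<close>

text \<open>The hypothesis on elements of order 2 enters through the dual: doubling is bijective on
  \<open>H\<close>, so sums over \<open>H\<close> may be reindexed by it and half sums exist. Since
  \<open>I - b\<close> may be singular, summation gives moduli one only on the image of
  \<open>(I + b) (I - b)^n\<close> for some \<open>n\<close>; a descent in \<open>n\<close> then
  removes the power. No function has to be recognised abstractly as a characteristic function: the
  character on \<open>(I + b) H\<close> is evaluation at a value taken by the
  \<open>G\<close>-component of \<open>\<xi>2\<close>, the common factor is the characteristic
  function of that component after the shift, and the Gaussians are images of the real normal law.
  The final identification rests on uniqueness: a measure on \<open>X\<close> is determined by the
  images of its slices over \<open>G\<close> under the coordinates at \<open>1 / n\<close>, and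
  these measures on the circle by their integer moments.\<close>

typedef (overloaded) ('g::ab_group_add) gchar = "{\<psi>::'g \<Rightarrow> complex. g_char \<psi>}"
  morphisms gval Abs_gchar
  by (rule exI[of _ "\<lambda>_. 1"]) (simp add: g_char_def)

setup_lifting type_definition_gchar

lemma g_char_zero: "g_char \<psi> \<Longrightarrow> \<psi> (0::'g::ab_group_add) = 1"
proof -
  assume h: "g_char \<psi>"
  have "\<psi> (0 + 0) = \<psi> 0 * \<psi> 0" using h unfolding g_char_def by blast
  moreover have "\<psi> 0 \<noteq> 0" using h unfolding g_char_def by (metis norm_zero zero_neq_one)
  ultimately show ?thesis by simp
qed

instantiation gchar :: (ab_group_add) ab_group_add
begin

lift_definition zero_gchar :: "'a gchar" is "\<lambda>_. 1" by (simp add: g_char_def)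
lift_definition plus_gchar :: "'a gchar \<Rightarrow> 'a gchar \<Rightarrow> 'a gchar" is "\<lambda>\<psi> \<phi> g. \<psi> g * \<phi> g"
  by (simp add: g_char_def norm_mult mult_ac)
lift_definition uminus_gchar :: "'a gchar \<Rightarrow> 'a gchar" is "\<lambda>\<psi> g. \<psi> (- g)"
proof -
  fix \<psi> :: "'a \<Rightarrow> complex" assume h: "g_char \<psi>"
  have "\<psi> (- (g + g')) = \<psi> (- g) * \<psi> (- g')" for g g'
    using h unfolding g_char_def by (metis minus_add_distrib)
  then show "g_char (\<lambda>g. \<psi> (- g))" using h unfolding g_char_def by blast
qed
definition minus_gchar :: "'a gchar \<Rightarrow> 'a gchar \<Rightarrow> 'a gchar" where
  "minus_gchar \<psi> \<phi> = \<psi> + (- \<phi>)"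

instance
proof
  fix p q r :: "'a gchar"
  show "p + q + r = p + (q + r)" "p + q = q + p" "0 + p = p"
    by (transfer, simp add: mult_ac)+
  show "- p + p = 0"
  proof transfer
    fix \<psi> :: "'a \<Rightarrow> complex" assume h: "g_char \<psi>"
    have "\<psi> (- g) * \<psi> g = 1" for g
      using h g_char_zero[OF h] unfolding g_char_def by (metis add.left_inverse)
    then show "(\<lambda>g. \<psi> (- g) * \<psi> g) = (\<lambda>_. 1)" by blast
  qed
  show "p - q = p + - q" by (rule minus_gchar_def)
qed

end

lemma g_char_gval: "g_char (gval h)"
  using gval by blast

lemma norm_gval [simp]: "cmod (gval h g) = 1"
  using g_char_gval[of h] by (simp add: g_char_def)

lemma gval_nonzero [simp]: "gval h g \<noteq> 0"
  using norm_gval[of h g] by fastforce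

lemma gval_add_right: "gval h (g + g') = gval h g * gval h g'"
  using g_char_gval[of h] by (simp add: g_char_def)

lemma gval_zero_right [simp]: "gval h 0 = 1"
  by (rule g_char_zero[OF g_char_gval])

lemma gval_add: "gval (h + h') g = gval h g * gval h' g"
  by transfer simp

lemma gval_zero [simp]: "gval 0 g = 1"
  by transfer simp

lemma gval_uminus: "gval (- h) g = gval h (- g)"
  by transfer simp

lemma gval_uminus_right: "gval h (- g) = cnj (gval h g)"
proof -
  have "gval h (- g) * gval h g = 1"
    by (metis add.left_inverse gval_add_right gval_zero_right)
  moreover have "cnj (gval h g) * gval h g = 1"
    by (metis complex_norm_square mult.commute norm_gval of_real_1 power_one)
  ultimately show ?thesis by (metis gval_nonzero mult_right_cancel)
qed

lemma gval_mult_cnj: "gval h g * cnj (gval h g) = 1"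
  by (metis complex_norm_square norm_gval of_real_1 power_one)

lemma gval_eqI: "(\<And>g. gval h g = gval h' g) \<Longrightarrow> h = h'"
  by transfer (rule ext)

section \<open>Extension of characters from subgroups of a finite group\<close>

primrec nmul :: "nat \<Rightarrow> 'g::ab_group_add \<Rightarrow> 'g" where
  "nmul 0 x = 0"
| "nmul (Suc n) x = x + nmul n x"

lemma nmul_add: "nmul (m + n) x = nmul m x + nmul n x"
  by (induction m) (simp_all add: add.assoc)

lemma nmul_mult: "nmul (m * n) x = nmul m (nmul n x)"
  by (induction m) (simp_all add: nmul_add)

lemma gval_nmul: "gval h (nmul n g) = gval h g ^ n"
  by (induction n) (simp_all add: gval_add_right)

lemma ex_nmul_zero:
  fixes x :: "'g::{ab_group_add, finite}"
  shows "\<exists>n>0. nmul n x = 0"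
proof -
  have "\<not> inj (\<lambda>n. nmul n x)"
    using finite_imageD[of "\<lambda>n. nmul n x" UNIV] by (metis finite infinite_UNIV_nat)
  then obtain i j where "i < j" "nmul i x = nmul j x"
    unfolding inj_def by (metis linorder_neqE_nat)
  then have "nmul (i + (j - i)) x = nmul i x" by simp
  then have "nmul (j - i) x = 0" unfolding nmul_add by simp
  then show ?thesis using \<open>i < j\<close> by (intro exI[of _ "j - i"]) simp
qed

text \<open>A partial character is encoded by its graph. On a finite group the three conditions below already
  imply closure under inverses, values of modulus one, and single-valuedness.\<close>

definition char_graph :: "('g::ab_group_add \<times> complex) set \<Rightarrow> bool" where
  "char_graph \<Gamma> \<longleftrightarrow> (0, 1) \<in> \<Gamma> \<and>
     (\<forall>g z g' z'. (g, z) \<in> \<Gamma> \<longrightarrow> (g', z') \<in> \<Gamma> \<longrightarrow> (g + g', z * z') \<in> \<Gamma>) \<and>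
     (\<forall>z. (0, z) \<in> \<Gamma> \<longrightarrow> z = 1)"

lemma char_graph_nmul:
  assumes "char_graph \<Gamma>" "(g, z) \<in> \<Gamma>"
  shows "(nmul n g, z ^ n) \<in> \<Gamma>"
  using assms by (induction n) (simp_all add: char_graph_def)

lemma char_graph_uminus:
  fixes g :: "'g::{ab_group_add, finite}"
  assumes "char_graph \<Gamma>" "(g, z) \<in> \<Gamma>"
  shows "(- g, inverse z) \<in> \<Gamma>"
proof -
  obtain n where n: "n > 0" "nmul n g = 0" using ex_nmul_zero by blast
  obtain m where m: "n = Suc m" using n(1) by (metis gr0_implies_Suc)
  have "(0, z ^ n) \<in> \<Gamma>" using char_graph_nmul[OF assms, of n] n(2) by simp
  then have "z * z ^ m = 1" using assms(1) m unfolding char_graph_def by force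
  moreover have "nmul m g = - g" using n(2) m by (simp add: eq_neg_iff_add_eq_0 add.commute)
  ultimately show ?thesis using char_graph_nmul[OF assms, of m] inverse_unique by metis
qed

lemma char_graph_norm:
  fixes g :: "'g::{ab_group_add, finite}"
  assumes "char_graph \<Gamma>" "(g, z) \<in> \<Gamma>"
  shows "cmod z = 1"
proof -
  obtain n where n: "n > 0" "nmul n g = 0" using ex_nmul_zero by blast
  have "(0, z ^ n) \<in> \<Gamma>" using char_graph_nmul[OF assms, of n] n(2) by simp
  then have "z ^ n = 1" using assms(1) unfolding char_graph_def by blast
  then have "cmod z ^ n = 1 ^ n" by (metis norm_one norm_power power_one)
  then show ?thesis using n(1) power_eq_imp_eq_base by (metis norm_ge_zero zero_le_one)
qed

lemma char_graph_functional:
  fixes g :: "'g::{ab_group_add, finite}"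
  assumes "char_graph \<Gamma>" "(g, z) \<in> \<Gamma>" "(g, z') \<in> \<Gamma>"
  shows "z = z'"
proof -
  have "(g + - g, z * inverse z') \<in> \<Gamma>"
    using assms char_graph_uminus[OF assms(1,3)] unfolding char_graph_def by blast
  then have "z * inverse z' = 1" using assms(1) unfolding char_graph_def by simp
  then show ?thesis by (metis inverse_inverse_eq inverse_unique mult.commute)
qed

text \<open>\<open>n\<close> is the order of \<open>y\<close> modulo the domain, so a value
  \<open>w\<close> at \<open>y\<close> is constrained only by the value already prescribed at
  \<open>nmul n y\<close>.\<close>

lemma char_graph_adjoin:
  fixes y :: "'g::{ab_group_add, finite}"
  assumes \<Gamma>: "char_graph \<Gamma>" and n: "n > 0" "(nmul n y, w ^ n) \<in> \<Gamma>"
    and least: "\<And>r. r < n \<Longrightarrow> nmul r y \<in> fst ` \<Gamma> \<Longrightarrow> r = 0"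
  shows "\<exists>\<Gamma>'. char_graph \<Gamma>' \<and> \<Gamma> \<subseteq> \<Gamma>' \<and> (y, w) \<in> \<Gamma>'"
proof -
  define \<Gamma>' where "\<Gamma>' = {(g + nmul k y, z * w ^ k) | g z k. (g, z) \<in> \<Gamma>}"
  have in': "(g + nmul k y, z * w ^ k) \<in> \<Gamma>'" if "(g, z) \<in> \<Gamma>" for g z k
    using that unfolding \<Gamma>'_def by blast
  have "char_graph \<Gamma>'"
    unfolding char_graph_def
  proof (intro conjI allI impI)
    show "(0, 1) \<in> \<Gamma>'" using in'[of 0 1 0] \<Gamma> by (simp add: char_graph_def)
  next
    fix g z g' z' assume "(g, z) \<in> \<Gamma>'" "(g', z') \<in> \<Gamma>'"
    then obtain g1 z1 k1 g2 z2 k2 where *: "(g1, z1) \<in> \<Gamma>" "(g2, z2) \<in> \<Gamma>"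
      and e: "g = g1 + nmul k1 y" "z = z1 * w ^ k1" "g' = g2 + nmul k2 y" "z' = z2 * w ^ k2"
      unfolding \<Gamma>'_def by blast
    have "(g1 + g2, z1 * z2) \<in> \<Gamma>" using * \<Gamma> unfolding char_graph_def by blast
    from in'[OF this, of "k1 + k2"] show "(g + g', z * z') \<in> \<Gamma>'"
      by (simp add: e nmul_add power_add algebra_simps)
  next
    fix u assume "(0, u) \<in> \<Gamma>'"
    then obtain g z k where gz: "(g, z) \<in> \<Gamma>" and e: "0 = g + nmul k y" "u = z * w ^ k"
      unfolding \<Gamma>'_def by blast
    \<comment> \<open>A relation \<open>0 = g + nmul k y\<close> leaves a remainder \<open>r\<close>
      with \<open>nmul r y\<close> in the domain; minimality of \<open>n\<close> forces
      \<open>r = 0\<close>, and the relation then lies inside \<open>\<Gamma>\<close>.\<close>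
    define q r where "q = k div n" and "r = k mod n"
    have k: "k = q * n + r" unfolding q_def r_def by simp
    have "(nmul (q * n) y, (w ^ n) ^ q) \<in> \<Gamma>"
      using char_graph_nmul[OF \<Gamma> n(2), of q] by (simp add: nmul_mult)
    then have b: "(g + nmul (q * n) y, z * (w ^ n) ^ q) \<in> \<Gamma>"
      using gz \<Gamma> unfolding char_graph_def by blast
    have "nmul r y = - (g + nmul (q * n) y)"
      using e(1) unfolding k nmul_add by (metis add.assoc add.commute eq_neg_iff_add_eq_0)
    then have "nmul r y \<in> fst ` \<Gamma>"
      using char_graph_uminus[OF \<Gamma> b] by (metis fst_conv image_eqI)
    then have r: "r = 0" using least n(1) unfolding r_def by simp
    have "g + nmul (q * n) y = 0" using e(1) k r by simp
    then have "z * (w ^ n) ^ q = 1" using b \<Gamma> unfolding char_graph_def by metis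
    then show "u = 1" using e(2) k r by (simp add: power_mult[symmetric] mult.commute)
  qed
  moreover have "\<Gamma> \<subseteq> \<Gamma>'"
  proof
    fix x assume "x \<in> \<Gamma>"
    then show "x \<in> \<Gamma>'" using in'[of "fst x" "snd x" 0] by simp
  qed
  moreover have "(y, w) \<in> \<Gamma>'"
    using in'[of 0 1 1] \<Gamma> by (simp add: char_graph_def)
  ultimately show ?thesis by blast
qed

text \<open>The value prescribed at the first multiple of \<open>y\<close> in the domain has modulus
  one, hence is nonzero and has an \<open>n\<close>-th root to serve as the value at
  \<open>y\<close>.\<close>

lemma char_graph_extend:
  fixes y :: "'g::{ab_group_add, finite}"
  assumes \<Gamma>: "char_graph \<Gamma>"
  shows "\<exists>\<Gamma>'. char_graph \<Gamma>' \<and> \<Gamma> \<subseteq> \<Gamma>' \<and> y \<in> fst ` \<Gamma>'"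
proof -
  define Q where "Q n \<longleftrightarrow> n > 0 \<and> nmul n y \<in> fst ` \<Gamma>" for n
  have "(0, 1) \<in> \<Gamma>" using \<Gamma> by (simp add: char_graph_def)
  then have "\<exists>n. Q n" unfolding Q_def using ex_nmul_zero[of y] by (metis fst_conv image_eqI)
  then have least: "Q (LEAST n. Q n)" by (metis LeastI_ex)
  define n where "n = (LEAST n. Q n)"
  have n: "n > 0" "nmul n y \<in> fst ` \<Gamma>" using least unfolding n_def Q_def by auto
  obtain z where z: "(nmul n y, z) \<in> \<Gamma>" using n(2) by force
  have "z \<noteq> 0" using char_graph_norm[OF \<Gamma> z] by auto
  then have "card {w. w ^ n = z} = n" using n(1) by (rule card_nth_roots)
  then have "{w. w ^ n = z} \<noteq> {}" using n(1) by (metis card.empty less_irrefl)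
  then obtain w where w: "w ^ n = z" by blast
  have "r = 0" if "r < n" "nmul r y \<in> fst ` \<Gamma>" for r
    using not_less_Least[of r Q] that unfolding n_def Q_def by simp
  then obtain \<Gamma>' where "char_graph \<Gamma>'" "\<Gamma> \<subseteq> \<Gamma>'" "(y, w) \<in> \<Gamma>'"
    using char_graph_adjoin[OF \<Gamma> n(1), of y w] z w by blast
  then show ?thesis by force
qed

text \<open>Adjoining the elements of the group one after another reaches a graph defined
  everywhere; being single-valued, it is the graph of a character.\<close>

lemma gchar_extends_char_graph:
  fixes \<Gamma> :: "('g::{ab_group_add, finite} \<times> complex) set"
  assumes \<Gamma>: "char_graph \<Gamma>"
  shows "\<exists>h. \<forall>(g, z)\<in>\<Gamma>. gval h g = z"
proof -
  have "\<exists>\<Gamma>'. char_graph \<Gamma>' \<and> \<Gamma> \<subseteq> \<Gamma>' \<and> S \<subseteq> fst ` \<Gamma>'" for S :: "'g set"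
  proof (induction S rule: infinite_finite_induct)
    case (insert y S)
    then obtain \<Gamma>1 where 1: "char_graph \<Gamma>1" "\<Gamma> \<subseteq> \<Gamma>1" "S \<subseteq> fst ` \<Gamma>1" by blast
    obtain \<Gamma>2 where "char_graph \<Gamma>2" "\<Gamma>1 \<subseteq> \<Gamma>2" "y \<in> fst ` \<Gamma>2"
      using char_graph_extend[OF 1(1)] by blast
    with 1 show ?case by (intro exI[of _ \<Gamma>2]) (auto simp: image_iff, blast+)
  qed (use \<Gamma> in auto)
  then obtain \<Gamma>' where \<Gamma>': "char_graph \<Gamma>'" "\<Gamma> \<subseteq> \<Gamma>'" "UNIV \<subseteq> fst ` \<Gamma>'" by blast
  define \<psi> where "\<psi> g = (THE z. (g, z) \<in> \<Gamma>')" for g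
  have \<psi>: "\<psi> g = z" if "(g, z) \<in> \<Gamma>'" for g z
    unfolding \<psi>_def using that char_graph_functional[OF \<Gamma>'(1)] by blast
  have mem: "(g, \<psi> g) \<in> \<Gamma>'" for g
    using \<Gamma>'(3) \<psi> by (metis UNIV_I image_iff prod.collapse subsetD)
  have "g_char \<psi>"
    unfolding g_char_def
    using char_graph_norm[OF \<Gamma>'(1) mem] \<psi> mem \<Gamma>'(1) unfolding char_graph_def by blast
  then have "gval (Abs_gchar \<psi>) = \<psi>" by (simp add: Abs_gchar_inverse)
  then show ?thesis using \<psi> \<Gamma>'(2) by (intro exI[of _ "Abs_gchar \<psi>"]) auto
qed

text \<open>If \<open>x\<close> has order \<open>n\<close>, any \<open>n\<close>-th root of unity is
  a possible value at \<open>x\<close>; as \<open>n > 1\<close>, one of them differs from 1, and the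
  partial character extends.\<close>

lemma gchar_separates:
  fixes x :: "'g::{ab_group_add, finite}"
  assumes "x \<noteq> 0"
  shows "\<exists>h. gval h x \<noteq> 1"
proof -
  define Q where "Q n \<longleftrightarrow> n > 0 \<and> nmul n x = 0" for n
  define n where "n = (LEAST n. Q n)"
  have "Q n" unfolding n_def using ex_nmul_zero[of x] by (metis LeastI_ex Q_def)
  then have n: "n > 0" "nmul n x = 0" unfolding Q_def by auto
  have "n \<noteq> 1" using n(2) assms by (metis One_nat_def add_0_right nmul.simps)
  with n(1) have "n > 1" by simp
  then have "card {w::complex. w ^ n = 1} = n" by (simp add: card_nth_roots)
  then have "\<not> {w::complex. w ^ n = 1} \<subseteq> {1}"
    using \<open>n > 1\<close> card_mono[of "{1::complex}" "{w. w ^ n = 1}"] by auto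
  then obtain w :: complex where w: "w ^ n = 1" "w \<noteq> 1" by blast
  have triv: "char_graph {(0::'g, 1)}" by (simp add: char_graph_def)
  have "r = 0" if "r < n" "nmul r x \<in> fst ` {(0::'g, 1::complex)}" for r
    using not_less_Least[of r Q] that unfolding n_def Q_def by simp
  then obtain \<Gamma> where "char_graph \<Gamma>" "(x, w) \<in> \<Gamma>"
    using char_graph_adjoin[OF triv n(1), of x w] n w(1) by auto
  then show ?thesis using gchar_extends_char_graph[of \<Gamma>] w(2) by fastforce
qed

text \<open>The value at \<open>g\<close> is a root of unity of an order depending only on
  \<open>g\<close>, so only finitely many functions qualify.\<close>

instance gchar :: ("{ab_group_add, finite}") finite
proof
  obtain N :: "'a \<Rightarrow> nat" where N: "\<And>g. N g > 0" "\<And>g. nmul (N g) g = 0"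
    using ex_nmul_zero by metis
  have "gval h g ^ N g = 1" for h and g :: 'a
    by (metis N(2) gval_nmul gval_zero_right)
  then have "range (gval :: 'a gchar \<Rightarrow> _) \<subseteq> (\<Pi>\<^sub>E g\<in>UNIV. {z. z ^ N g = 1})" by auto
  moreover have "finite (\<Pi>\<^sub>E g\<in>UNIV. {z::complex. z ^ N g = 1})"
    using N(1) by (intro finite_PiE) auto
  ultimately have "finite (range (gval :: 'a gchar \<Rightarrow> _))" by (rule finite_subset)
  moreover have "inj (gval :: 'a gchar \<Rightarrow> _)" by (simp add: inj_def gval_inject)
  ultimately show "finite (UNIV :: 'a gchar set)" by (rule finite_imageD)
qed

text \<open>Orthogonality: translating the index by a character \<open>k\<close> with
  \<open>gval k x \<noteq> 1\<close> multiplies the sum by \<open>gval k x\<close>, so it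
  vanishes.\<close>

lemma sum_gval:
  fixes x :: "'g::{ab_group_add, finite}"
  shows "(\<Sum>h\<in>UNIV. gval h x) = (if x = 0 then of_nat CARD('g gchar) else 0)"
proof (cases "x = 0")
  case False
  then obtain k where k: "gval k x \<noteq> 1" using gchar_separates by blast
  have "(\<Sum>h\<in>UNIV. gval h x) = (\<Sum>h\<in>UNIV. gval (k + h) x)"
    by (rule sum.reindex_bij_witness[of _ "\<lambda>h. k + h" "\<lambda>h. h - k"]) auto
  also have "\<dots> = gval k x * (\<Sum>h\<in>UNIV. gval h x)"
    by (simp add: gval_add sum_distrib_left)
  finally show ?thesis using k False by (metis mult_cancel_right1)
qed simp

text \<open>Fourier inversion on \<open>G\<close>, which lets the slices
  \<open>snd x \<in> S\<close> be tested with characters.\<close>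

lemma indicator_gval:
  fixes S :: "'g::{ab_group_add, finite} set"
  shows "\<exists>c. \<forall>x. (indicator S x :: complex) = (\<Sum>h\<in>UNIV. c h * gval h x)"
\<comment> \<open>The coefficients stay schematic until the last line, which fixes them as the
  Fourier coefficients of \<open>indicator S\<close>.\<close>
proof (intro exI allI)
  fix x
  let ?n = "of_nat CARD('g gchar) :: complex"
  have "(\<Sum>h\<in>UNIV. ((\<Sum>s\<in>S. gval h (- s)) / ?n) * gval h x) = (\<Sum>h\<in>UNIV. \<Sum>s\<in>S. gval h (x - s) / ?n)"
    by (simp add: sum_divide_distrib sum_distrib_right gval_add_right[symmetric] add.commute)
  also have "\<dots> = (\<Sum>s\<in>S. (\<Sum>h\<in>UNIV. gval h (x - s)) / ?n)"
    by (subst sum.swap) (simp add: sum_divide_distrib)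
  also have "\<dots> = (\<Sum>s\<in>S. if s = x then 1 else 0)"
    by (intro sum.cong refl) (auto simp: sum_gval)
  also have "\<dots> = indicator S x" by (simp add: indicator_def)
  finally show "indicator S x = (\<Sum>h\<in>UNIV. ((\<Sum>s\<in>S. gval h (- s)) / ?n) * gval h x)" by simp
qed

section \<open>Uniqueness of characteristic functions\<close>

lemma cnj_eq_inverse_if_norm_one: "cmod z = 1 \<Longrightarrow> cnj z = inverse z"
  by (metis complex_norm_square inverse_unique mult.commute of_real_1 power_one)

text \<open>The identity is required only on the circle, where \<open>cnj z\<close> is
  \<open>z powi (-1)\<close>; this is what turns real polynomials in the two coordinates into
  Laurent polynomials.\<close>

definition trig_poly :: "(complex \<Rightarrow> complex) \<Rightarrow> bool" where
  "trig_poly f \<longleftrightarrow> (\<exists>I c. finite I \<and> (\<forall>z. cmod z = 1 \<longrightarrow> f z = (\<Sum>k\<in>I. c k * z powi (k::int))))"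

lemma trig_poly_term: "trig_poly (\<lambda>z. c * z powi k)"
  unfolding trig_poly_def by (rule exI[of _ "{k}"], rule exI[of _ "\<lambda>_. c"]) simp

lemma trig_poly_cong: "trig_poly f \<Longrightarrow> (\<And>z. cmod z = 1 \<Longrightarrow> g z = f z) \<Longrightarrow> trig_poly g"
  unfolding trig_poly_def by simp

lemma trig_poly_add:
  assumes "trig_poly f" "trig_poly g"
  shows "trig_poly (\<lambda>z. f z + g z)"
proof -
  obtain I c where I: "finite I" "\<And>z. cmod z = 1 \<Longrightarrow> f z = (\<Sum>k\<in>I. c k * z powi (k::int))"
    using assms(1) unfolding trig_poly_def by blast
  obtain J d where J: "finite J" "\<And>z. cmod z = 1 \<Longrightarrow> g z = (\<Sum>k\<in>J. d k * z powi (k::int))"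
    using assms(2) unfolding trig_poly_def by blast
  define e where "e k = (if k \<in> I then c k else 0) + (if k \<in> J then d k else 0)" for k
  have "f z + g z = (\<Sum>k\<in>I \<union> J. e k * z powi k)" if "cmod z = 1" for z
  proof -
    have "(\<Sum>k\<in>I \<union> J. e k * z powi k) = (\<Sum>k\<in>I \<union> J. (if k \<in> I then c k * z powi k else 0))
       + (\<Sum>k\<in>I \<union> J. (if k \<in> J then d k * z powi k else 0))"
      by (subst sum.distrib[symmetric], intro sum.cong) (auto simp: e_def distrib_right)
    also have "\<dots> = f z + g z"
      using I J that by (simp add: sum.If_cases Int_absorb1)
    finally show ?thesis by simp
  qed
  then show ?thesis using I(1) J(1) unfolding trig_poly_def by (meson finite_UnI)
qed

lemma trig_poly_sum:
  "(\<And>k. k \<in> I \<Longrightarrow> trig_poly (f k)) \<Longrightarrow> trig_poly (\<lambda>z. \<Sum>k\<in>I. f k z)"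
proof (induction I rule: infinite_finite_induct)
  case (insert x F)
  then show ?case by (simp add: trig_poly_add)
qed (use trig_poly_term[of 0 0] in simp_all)

lemma trig_poly_mult:
  assumes "trig_poly f" "trig_poly g"
  shows "trig_poly (\<lambda>z. f z * g z)"
proof -
  obtain I c where I: "finite I" "\<And>z. cmod z = 1 \<Longrightarrow> f z = (\<Sum>k\<in>I. c k * z powi (k::int))"
    using assms(1) unfolding trig_poly_def by blast
  obtain J d where J: "finite J" "\<And>z. cmod z = 1 \<Longrightarrow> g z = (\<Sum>k\<in>J. d k * z powi (k::int))"
    using assms(2) unfolding trig_poly_def by blast
  have "trig_poly (\<lambda>z. \<Sum>k\<in>I. \<Sum>l\<in>J. (c k * d l) * z powi (k + l))"
    by (intro trig_poly_sum trig_poly_term)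
  then show ?thesis
  proof (rule trig_poly_cong)
    fix z :: complex assume z: "cmod z = 1"
    then have "z \<noteq> 0" by auto
    then show "f z * g z = (\<Sum>k\<in>I. \<Sum>l\<in>J. (c k * d l) * z powi (k + l))"
      by (simp add: I(2)[OF z] J(2)[OF z] sum_product power_int_add mult_ac)
  qed
qed

text \<open>On the circle the real part is \<open>(z + 1/z) / 2\<close> and the imaginary part
  \<open>(z - 1/z) / 2i\<close>, whence the coefficients in the linear case.\<close>

lemma trig_poly_real_polynomial_function:
  fixes p :: "complex \<Rightarrow> real"
  assumes "real_polynomial_function p"
  shows "trig_poly (\<lambda>z. of_real (p z))"
  using assms
proof induction
  case (linear f)
  let ?a = "complex_of_real (f 1)" and ?b = "complex_of_real (f \<i>)"
  have f: "f z = Re z * f 1 + Im z * f \<i>" for z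
  proof -
    interpret bounded_linear f by fact
    have "f z = f (Re z *\<^sub>R 1 + Im z *\<^sub>R \<i>)"
      by (metis complex_eq mult.commute scaleR_conv_of_real mult.right_neutral)
    then show ?thesis by (simp add: add scale)
  qed
  have "trig_poly (\<lambda>z. ((?a - \<i> * ?b) / 2) * z powi 1 + ((?a + \<i> * ?b) / 2) * z powi (-1))"
    by (intro trig_poly_add trig_poly_term)
  then show ?case
  proof (rule trig_poly_cong)
    fix z assume z: "cmod z = 1"
    have "z powi (-1) = cnj z" using z by (simp add: cnj_eq_inverse_if_norm_one power_int_minus)
    then show "of_real (f z) = ((?a - \<i> * ?b) / 2) * z powi 1 + ((?a + \<i> * ?b) / 2) * z powi (-1)"
      by (simp only:) (simp add: complex_eq_iff f[of z] field_simps)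
  qed
next
  case (const c)
  then show ?case using trig_poly_term[of "of_real c" 0] by simp
qed (simp_all add: trig_poly_add trig_poly_mult)

text \<open>Equality of moments passes to trigonometric polynomials, by Stone-Weierstrass to
  continuous functions, and by dominated convergence to closed sets, an intersection-stable
  generator. Total mass one is not assumed, because the measures compared later are restricted to a
  slice over \<open>G\<close>.\<close>

lemma circle_measure_eqI:
  assumes M: "finite_measure M" "sets M = sets borel" "AE z in M. cmod z = 1"
    and N: "finite_measure N" "sets N = sets borel" "AE z in N. cmod z = 1"
    and eq: "\<And>k::int. (LINT z|M. z powi k) = (LINT z|N. z powi k)"
  shows "M = N"
proof -
  have trig: "(LINT z|M. f z) = (LINT z|N. f z)" if f: "trig_poly f" "f \<in> borel_measurable borel" for f
  proof -
    obtain I c where I: "finite I" "\<And>z. cmod z = 1 \<Longrightarrow> f z = (\<Sum>k\<in>I. c k * z powi (k::int))"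
      using f(1) unfolding trig_poly_def by blast
    have *: "(LINT z|L. f z) = (\<Sum>k\<in>I. c k * (LINT z|L. z powi k))"
      if L: "finite_measure L" "sets L = sets borel" "AE z in L. cmod z = 1" for L
    proof -
      interpret finite_measure L by fact
      note [measurable_cong] = L(2)
      have meas: "(\<lambda>z::complex. z powi k) \<in> borel_measurable borel" for k
      proof (cases "k \<ge> 0")
        case True then show ?thesis by (simp add: power_int_def)
      next
        case False then show ?thesis by (simp add: power_int_def)
      qed
      have int: "integrable L (\<lambda>z. z powi k)" for k :: int
        by (rule integrable_const_bound[where B = 1])
          (use L in \<open>auto simp: norm_power_int meas cong: measurable_cong_sets\<close>)
      have "(LINT z|L. f z) = (LINT z|L. (\<Sum>k\<in>I. c k * z powi k))"
        using L(2,3) f(2) by (intro integral_cong_AE) (auto simp: I(2) meas cong: measurable_cong_sets intro!: borel_measurable_sum borel_measurable_times)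
      also have "\<dots> = (\<Sum>k\<in>I. c k * (LINT z|L. z powi k))"
        using int by (subst Bochner_Integration.integral_sum) auto
      finally show ?thesis .
    qed
    show ?thesis using *[OF M] *[OF N] eq by simp
  qed
  have cont: "(LINT z|M. g z) = (LINT z|N. g z)" if g: "continuous_on UNIV g" for g :: "complex \<Rightarrow> real"
  proof -
    have gm: "g \<in> borel_measurable borel" using g by (rule borel_measurable_continuous_onI)
    have cg: "continuous_on (sphere 0 1) g" using g continuous_on_subset by blast
    have bound: "\<bar>(LINT z|L. g z) - (LINT z|L. p z)\<bar> \<le> e * measure L (space L)"
      if L: "finite_measure L" "sets L = sets borel" "AE z in L. cmod z = 1"
        and p: "continuous_on UNIV p" "\<And>z. z \<in> sphere 0 1 \<Longrightarrow> \<bar>g z - p z\<bar> < e" for L p e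
    proof -
      interpret finite_measure L by fact
      have int: "integrable L q" if q: "continuous_on UNIV q" for q :: "complex \<Rightarrow> real"
      proof -
        have "compact (q ` sphere 0 1)"
          using q by (intro compact_continuous_image) (auto intro: continuous_on_subset)
        then have "bounded (q ` sphere 0 1)" by (rule compact_imp_bounded)
        then obtain B where "\<And>x. x \<in> sphere 0 1 \<Longrightarrow> norm (q x) \<le> B"
          unfolding bounded_iff by blast
        then show ?thesis
          using L borel_measurable_continuous_onI[OF q]
          by (intro integrable_const_bound[where B = B]) (auto cong: measurable_cong_sets)
      qed
      have "(LINT z|L. g z) - (LINT z|L. p z) = (LINT z|L. g z - p z)"
        using int g p(1) by simp
      also have "\<bar>\<dots>\<bar> \<le> (LINT z|L. \<bar>g z - p z\<bar>)"
        using integral_norm_bound[of L "\<lambda>z. g z - p z"] by simp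
      also have "\<dots> \<le> (LINT z|L. e)"
        using L(3) p(2) int g p(1)
        by (intro integral_mono_AE) (auto intro!: less_imp_le elim!: eventually_mono)
      finally show "\<bar>(LINT z|L. g z) - (LINT z|L. p z)\<bar> \<le> e * measure L (space L)"
        by (simp add: mult.commute)
    qed
    have small: "\<bar>(LINT z|M. g z) - (LINT z|N. g z)\<bar> \<le> e * (measure M (space M) + measure N (space N))"
      if e: "e > 0" for e
    proof -
      obtain p where p: "real_polynomial_function p" "\<And>z. z \<in> sphere 0 1 \<Longrightarrow> \<bar>g z - p z\<bar> < e"
        using Stone_Weierstrass_real_polynomial_function[of "sphere 0 1" g e] cg e by auto
      have pc: "continuous_on UNIV p"
        using p(1) by (simp add: continuous_on_polymonial_function real_polynomial_function_eq)
      have "(LINT z|M. complex_of_real (p z)) = (LINT z|N. complex_of_real (p z))"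
        using borel_measurable_continuous_onI[OF pc]
        by (intro trig trig_poly_real_polynomial_function p(1)) measurable
      then have "(LINT z|M. p z) = (LINT z|N. p z)" by simp
      then show ?thesis using bound[OF M pc p(2)] bound[OF N pc p(2)] by (simp add: algebra_simps)
    qed
    show ?thesis
    proof (rule ccontr)
      assume ne: "(LINT z|M. g z) \<noteq> (LINT z|N. g z)"
      define K where "K = measure M (space M) + measure N (space N)"
      define d where "d = \<bar>(LINT z|M. g z) - (LINT z|N. g z)\<bar>"
      have "K \<ge> 0" "d > 0" using ne by (simp_all add: K_def d_def)
      \<comment> \<open>The denominator contains \<open>K + 1\<close> so that total mass zero is
        covered.\<close>
      then have "d / (2 * (K + 1)) > 0" by simp
      from small[OF this] have "d \<le> (d / (2 * (K + 1))) * K" by (simp add: K_def d_def)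
      also have "\<dots> < d" using \<open>K \<ge> 0\<close> \<open>d > 0\<close> by (simp add: field_simps add_nonneg_pos)
      finally show False by simp
    qed
  qed
  have closed_eq: "measure M C = measure N C" if C: "closed C" for C
  \<comment> \<open>\<open>infdist\<close> to the empty set is 0 by convention, so the cut-offs
    \<open>u n\<close> below would be constantly 1 for it.\<close>
  proof (cases "C = {}")
    case False
    \<comment> \<open>Cut-offs of slope \<open>n\<close>: equal to 1 on \<open>C\<close>, and
      eventually 0 at each point outside, which has positive distance from the closed set.\<close>
    define u where "u n z = max 0 (1 - real n * infdist z C)" for n and z :: complex
    have uc: "continuous_on UNIV (u n)" for n
      unfolding u_def by (intro continuous_intros)
    have lim: "(\<lambda>n. u n z) \<longlonglongrightarrow> indicator C z" for z
    proof (cases "z \<in> C")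
      case True
      then show ?thesis by (simp add: u_def)
    next
      case nz: False
      then have pos: "infdist z C > 0" using C False by (simp add: infdist_pos_not_in_closed)
      obtain m where m: "1 < real m * infdist z C" using pos reals_Archimedean3 by blast
      have "u n z = 0" if "n \<ge> m" for n
      proof -
        have "real m * infdist z C \<le> real n * infdist z C" using that pos by (intro mult_right_mono) auto
        then show ?thesis using m by (simp add: u_def)
      qed
      then show ?thesis using nz
        by (intro tendsto_eventually eventually_sequentiallyI[of m]) simp
    qed
    have conv: "(\<lambda>n. LINT z|L. u n z) \<longlonglongrightarrow> measure L C"
      if L: "finite_measure L" "sets L = sets borel" for L
    proof -
      interpret finite_measure L by fact
      have "(\<lambda>n. LINT z|L. u n z) \<longlonglongrightarrow> (LINT z|L. indicator C z)"
      proof (rule integral_dominated_convergence[where w = "\<lambda>_. 1"])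
        show "(\<lambda>z. indicator C z :: real) \<in> borel_measurable L" using L(2) C by (auto cong: measurable_cong_sets)
        show "u n \<in> borel_measurable L" for n using L(2) borel_measurable_continuous_onI[OF uc]
          by (auto cong: measurable_cong_sets)
        show "integrable L (\<lambda>_. 1::real)" by simp
        show "AE z in L. (\<lambda>n. u n z) \<longlonglongrightarrow> indicator C z" using lim by simp
        show "AE z in L. norm (u n z) \<le> 1" for n by (simp add: u_def infdist_nonneg)
      qed
      then show ?thesis using sets_eq_imp_space_eq[OF L(2)] by simp
    qed
    show ?thesis
      using conv[OF M(1,2)] conv[OF N(1,2)] cont[OF uc] by (auto intro: LIMSEQ_unique)
  qed simp
  show ?thesis
  proof (rule measure_eqI_generator_eq[where E = "Collect closed" and \<Omega> = UNIV and A = "\<lambda>_. UNIV"])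
    show "Int_stable (Collect closed :: complex set set)" by (auto simp: Int_stable_def)
    show "sets M = sigma_sets UNIV (Collect closed)" "sets N = sigma_sets UNIV (Collect closed)"
      using M(2) N(2) by (simp_all add: borel_eq_closed)
    show "emeasure M X = emeasure N X" if "X \<in> Collect closed" for X
      using closed_eq that by (simp add: finite_measure.emeasure_eq_measure M(1) N(1))
    show "emeasure M UNIV \<noteq> \<infinity>" using M(1) by (simp add: finite_measure.emeasure_eq_measure)
  qed auto
qed

section \<open>Coordinates and the sigma algebra of X\<close>

lemma space_sol_M [simp]: "space sol_M = sol"
  by (simp add: sol_M_def space_restrict_space space_PiM)

lemma space_X_M [simp]: "space X_M = sol \<times> UNIV"
  by (simp add: X_M_def space_pair_measure)

lemma sol_norm: "c \<in> sol \<Longrightarrow> cmod (c r) = 1"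
  by (simp add: sol_def)

lemma sol_nonzero: "c \<in> sol \<Longrightarrow> c r \<noteq> 0"
  using sol_norm[of c r] by auto

lemma sol_add: "c \<in> sol \<Longrightarrow> c (r + s) = c r * c s"
  by (simp add: sol_def)

lemma sol_zero: "c \<in> sol \<Longrightarrow> c 0 = 1"
  using sol_add[of c 0 0] sol_nonzero[of c 0] by simp

lemma sol_uminus: "c \<in> sol \<Longrightarrow> c (- r) = cnj (c r)"
  using sol_add[of c r "- r"] sol_zero[of c] sol_norm[of c r]
  by (simp add: cnj_eq_inverse_if_norm_one) (metis inverse_unique)

lemma sol_of_nat: "c \<in> sol \<Longrightarrow> c (of_nat n * r) = c r ^ n"
  by (induction n) (simp_all add: sol_zero sol_add distrib_right)

lemma sol_of_int: "c \<in> sol \<Longrightarrow> c (of_int k * r) = c r powi k"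
proof (cases "k \<ge> 0")
  case True
  assume c: "c \<in> sol"
  show ?thesis using sol_of_nat[OF c, of "nat k" r] True by (simp add: power_int_def)
next
  case False
  assume c: "c \<in> sol"
  have "c (of_int k * r) = c (- (of_nat (nat (- k)) * r))" using False by simp
  then show ?thesis using sol_of_nat[OF c, of "nat (- k)" r] False sol_norm[OF c, of r]
    unfolding sol_uminus[OF c] by (simp add: power_int_def cnj_eq_inverse_if_norm_one)
qed

lemma sol_mult: "c \<in> sol \<Longrightarrow> d \<in> sol \<Longrightarrow> (\<lambda>r. c r * d r) \<in> sol"
  by (simp add: sol_def norm_mult mult_ac)

lemma sol_scale: "c \<in> sol \<Longrightarrow> (\<lambda>r. c (a * r)) \<in> sol"
  by (simp add: sol_def distrib_left)

lemma sol_one: "(\<lambda>r. 1) \<in> sol"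
  by (simp add: sol_def)

lemma measurable_sol_component [measurable]: "(\<lambda>c. c r) \<in> borel_measurable sol_M"
  unfolding sol_M_def by (intro measurable_restrict_space1 measurable_component_singleton) simp

lemma measurable_sol_MI:
  assumes "\<And>x. x \<in> space M \<Longrightarrow> f x \<in> sol" "\<And>r. (\<lambda>x. f x r) \<in> borel_measurable M"
  shows "f \<in> measurable M sol_M"
  unfolding sol_M_def
proof (rule measurable_restrict_space2)
  show "f \<in> space M \<rightarrow> sol" using assms(1) by simp
  have "(\<lambda>x. \<lambda>r\<in>UNIV. f x r) \<in> measurable M (PiM UNIV (\<lambda>_. borel))"
    using assms(2) by (intro measurable_restrict) simp
  then show "f \<in> measurable M (PiM UNIV (\<lambda>_. borel))" by (simp add: restrict_def)
qed

lemma measurable_X_fst [measurable]: "fst \<in> measurable X_M sol_M"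
  by (simp add: X_M_def)

lemma measurable_X_snd [measurable]: "snd \<in> measurable X_M (count_space UNIV)"
  by (simp add: X_M_def)

lemma measurable_X_fst_component [measurable]: "(\<lambda>x. fst x r) \<in> borel_measurable X_M"
  using measurable_comp[OF measurable_X_fst measurable_sol_component] by (simp add: comp_def)

lemma measurable_X_char [measurable]: "(\<lambda>x. fst x r * gval h (snd x)) \<in> borel_measurable X_M"
proof (rule borel_measurable_times[OF measurable_X_fst_component])
  show "(\<lambda>x. gval h (snd x)) \<in> borel_measurable X_M"
    by (rule measurable_compose[OF measurable_X_snd]) simp
qed

lemma measurable_X_MI:
  assumes "\<And>x. x \<in> space M \<Longrightarrow> fst (f x) \<in> sol" "\<And>r. (\<lambda>x. fst (f x) r) \<in> borel_measurable M"
    "(\<lambda>x. snd (f x)) \<in> measurable M (count_space UNIV)"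
  shows "f \<in> measurable M X_M"
  unfolding X_M_def using measurable_sol_MI[of M "\<lambda>x. fst (f x)"] assms
  by (intro measurable_pair) (simp_all add: comp_def)

text \<open>Finitely many rationals lie in one cyclic group generated by some \<open>1 / n\<close>,
  so a single coordinate replaces finite sets of coordinates, and its powers are the coordinates at
  \<open>k / n\<close>.\<close>

definition X_cylinder :: "nat \<Rightarrow> complex set \<Rightarrow> 'g set \<Rightarrow> ((rat \<Rightarrow> complex) \<times> 'g) set" where
  "X_cylinder n B S = {x \<in> sol \<times> UNIV. fst x (1 / of_nat n) \<in> B \<and> snd x \<in> S}"

definition X_cylinders :: "((rat \<Rightarrow> complex) \<times> 'g) set set" where
  "X_cylinders = {X_cylinder n B S | n B S. n > 0 \<and> B \<in> sets borel}"

text \<open>\<open>1 / n\<close> is \<open>m\<close> times \<open>1 / (n * m)\<close>; two cylinders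
  can thus be written with a common coordinate, which makes them closed under intersection.\<close>

lemma X_cylinder_refine:
  assumes "n > 0" "m > 0"
  shows "X_cylinder n B S = X_cylinder (n * m) ((\<lambda>z. z ^ m) -` B) S"
proof -
  have "c (1 / of_nat n) = c (1 / of_nat (n * m)) ^ m" if "c \<in> sol" for c
    using sol_of_nat[OF that, of m "1 / of_nat (n * m)"] assms by simp
  then show ?thesis by (auto simp: X_cylinder_def)
qed

lemma sets_X_M_eq: "sets X_M = sigma_sets (sol \<times> UNIV) (X_cylinders :: ((rat \<Rightarrow> complex) \<times> 'g::finite) set set)"
proof
  let ?E = "X_cylinders :: ((rat \<Rightarrow> complex) \<times> 'g) set set"
  have sub: "?E \<subseteq> Pow (sol \<times> UNIV)" by (auto simp: X_cylinders_def X_cylinder_def)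
  define E where "E = sigma (sol \<times> UNIV) ?E"
  have sets_E: "sets E = sigma_sets (sol \<times> UNIV) ?E" and space_E: "space E = sol \<times> UNIV"
    using sub by (simp_all add: E_def)
  have cyl: "X_cylinder n B S \<in> sets E" if "n > 0" "B \<in> sets borel" for n B and S :: "'g set"
    unfolding sets_E using that by (intro sigma_sets.Basic) (auto simp: X_cylinders_def)
  \<comment> \<open>Measurability of the identity from \<open>E\<close> yields the inclusion of
    \<open>sets X_M\<close> in the generated algebra; the coordinate at \<open>p / q\<close> is an
    integer power of the coordinate at \<open>1 / q\<close>.\<close>
  have "(\<lambda>x. x) \<in> measurable E (X_M :: ((rat \<Rightarrow> complex) \<times> 'g) measure)"
  proof (rule measurable_X_MI)
    show "fst x \<in> sol" if "x \<in> space E" for x using that space_E by auto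
    show "snd \<in> measurable E (count_space UNIV)"
    proof (rule measurableI)
      fix A :: "'g set"
      have "snd -` A \<inter> space E = X_cylinder 1 UNIV A" by (auto simp: X_cylinder_def space_E)
      then show "snd -` A \<inter> space E \<in> sets E" using cyl[of 1 UNIV A] by simp
    qed simp
    fix r :: rat
    obtain p q where r: "r = of_int p / of_int q" "q > 0"
      by (metis quotient_of_denom_pos quotient_of_div surj_pair)
    define n where "n = nat q"
    have n: "n > 0" "of_int q = (of_nat n :: rat)" using r(2) by (simp_all add: n_def)
    have gen: "(\<lambda>x. fst x (1 / of_nat n)) \<in> borel_measurable E"
    proof (rule measurableI)
      fix A :: "complex set" assume A: "A \<in> sets borel"
      have "(\<lambda>x. fst x (1 / of_nat n)) -` A \<inter> space E = X_cylinder n A UNIV"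
        by (auto simp: X_cylinder_def space_E)
      then show "(\<lambda>x. fst x (1 / of_nat n)) -` A \<inter> space E \<in> sets E"
        using cyl[OF n(1) A, of UNIV] by simp
    qed simp
    have eq: "fst x r = (if p \<ge> 0 then fst x (1 / of_nat n) ^ nat p else inverse (fst x (1 / of_nat n)) ^ nat (- p))"
      if "x \<in> space E" for x
    proof -
      have "fst x \<in> sol" using that space_E by auto
      then show ?thesis using sol_of_int[of "fst x" p "1 / of_nat n"] r(1) n(2)
        by (simp add: power_int_def)
    qed
    have "(\<lambda>x. if p \<ge> 0 then fst x (1 / of_nat n) ^ nat p else inverse (fst x (1 / of_nat n)) ^ nat (- p))
        \<in> borel_measurable E"
      using gen by measurable
    then show "(\<lambda>x. fst x r) \<in> borel_measurable E"
      by (subst measurable_cong[OF eq])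
  qed
  then show "sets X_M \<subseteq> sigma_sets (sol \<times> UNIV) ?E"
    unfolding sets_E[symmetric]
    using measurable_sets[of "\<lambda>x. x" E "X_M :: ((rat \<Rightarrow> complex) \<times> 'g) measure"] sets.sets_into_space[of _ X_M] space_E
    by (fastforce simp: Int_absorb2)
  show "sigma_sets (sol \<times> UNIV) ?E \<subseteq> sets X_M"
  proof -
    have "X \<in> sets X_M" if "X \<in> ?E" for X
    proof -
      obtain n B S where X: "X = X_cylinder n B S" "B \<in> sets borel"
        using \<open>X \<in> ?E\<close> unfolding X_cylinders_def by blast
      have "X = (\<lambda>x. fst x (1 / of_nat n)) -` B \<inter> space X_M \<inter> (snd -` S \<inter> space X_M)"
        unfolding X by (auto simp: X_cylinder_def)
      then show ?thesis
        using measurable_sets[OF measurable_X_fst_component X(2)] measurable_sets[OF measurable_X_snd, of S] by auto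
    qed
    then show ?thesis using sets.sigma_sets_subset[of ?E X_M] by auto
  qed
qed

definition charf :: "((rat \<Rightarrow> complex) \<times> 'g::ab_group_add) measure \<Rightarrow> rat \<Rightarrow> 'g gchar \<Rightarrow> complex" where
  "charf \<mu> r h = charfun_X \<mu> r (gval h)"

lemma X_char_integrable:
  assumes "prob_space \<mu>" "sets \<mu> = sets X_M"
  shows "integrable \<mu> (\<lambda>x. fst x r * gval h (snd x))"
proof -
  interpret prob_space \<mu> by fact
  have "space \<mu> = sol \<times> UNIV" using sets_eq_imp_space_eq[OF assms(2)] by simp
  then show ?thesis
    using assms(2) by (intro integrable_const_bound[where B = 1])
      (auto simp: norm_mult sol_norm cong: measurable_cong_sets)
qed

text \<open>The measures agree on a cylinder once their slices over \<open>S\<close> have the same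
  image on the circle under the coordinate at \<open>1 / n\<close>. The \<open>k\<close>-th moment
  of that image is a combination of values of \<open>charf\<close> at \<open>k / n\<close>, by the
  Fourier expansion of \<open>indicator S\<close>.\<close>

lemma X_measure_eqI:
  fixes \<mu> \<nu> :: "((rat \<Rightarrow> complex) \<times> 'g::{ab_group_add, finite}) measure"
  assumes \<mu>: "prob_space \<mu>" "sets \<mu> = sets X_M"
    and \<nu>: "prob_space \<nu>" "sets \<nu> = sets X_M"
    and eq: "\<And>r h. charf \<mu> r h = charf \<nu> r h"
  shows "\<mu> = \<nu>"
proof (rule measure_eqI_generator_eq[where E = X_cylinders and \<Omega> = "sol \<times> UNIV" and A = "\<lambda>_. sol \<times> UNIV"])
  show "Int_stable (X_cylinders :: ((rat \<Rightarrow> complex) \<times> 'g) set set)"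
    unfolding Int_stable_def
  proof (intro ballI)
    fix A B :: "((rat \<Rightarrow> complex) \<times> 'g) set" assume "A \<in> X_cylinders" "B \<in> X_cylinders"
    then obtain n C S m D T where A: "A = X_cylinder n C S" "n > 0" "C \<in> sets borel"
      and B: "B = X_cylinder m D T" "m > 0" "D \<in> sets borel"
      unfolding X_cylinders_def by blast
    let ?C = "(\<lambda>z::complex. z ^ m) -` C" and ?D = "(\<lambda>z::complex. z ^ n) -` D"
    have "A = X_cylinder (n * m) ?C S" "B = X_cylinder (n * m) ?D T"
      using X_cylinder_refine[OF A(2) B(2)] X_cylinder_refine[OF B(2) A(2)] A B by (simp_all add: mult.commute)
    then have "A \<inter> B = X_cylinder (n * m) (?C \<inter> ?D) (S \<inter> T)"
      by (auto simp: X_cylinder_def)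
    moreover have "?C \<inter> ?D \<in> sets borel"
      using measurable_sets[of "\<lambda>z::complex. z ^ m" borel borel C] measurable_sets[of "\<lambda>z::complex. z ^ n" borel borel D] A B by auto
    ultimately show "A \<inter> B \<in> X_cylinders"
      using A(2) B(2) unfolding X_cylinders_def by fastforce
  qed
  show "X_cylinders \<subseteq> Pow (sol \<times> UNIV)" by (auto simp: X_cylinders_def X_cylinder_def)
  show "sets \<mu> = sigma_sets (sol \<times> UNIV) X_cylinders" "sets \<nu> = sigma_sets (sol \<times> UNIV) X_cylinders"
    using \<mu>(2) \<nu>(2) sets_X_M_eq by simp_all
  have "sol \<times> UNIV = X_cylinder 1 UNIV UNIV" by (auto simp: X_cylinder_def)
  then show "range (\<lambda>_::nat. sol \<times> UNIV) \<subseteq> X_cylinders"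
    unfolding X_cylinders_def by (auto intro!: exI[of _ 1] exI[of _ UNIV])
  show "emeasure \<mu> (sol \<times> UNIV) \<noteq> \<infinity>"
    using \<mu>(1) by (simp add: prob_space_def finite_measure.emeasure_eq_measure)
  show "emeasure \<mu> X = emeasure \<nu> X" if X: "X \<in> X_cylinders" for X
  proof -
    obtain n B S where X: "X = X_cylinder n B S" "B \<in> sets borel"
      using \<open>X \<in> X_cylinders\<close> unfolding X_cylinders_def by blast
    define proj where "proj = (\<lambda>x :: (rat \<Rightarrow> complex) \<times> 'g. fst x (1 / of_nat n))"
    define R where "R L = distr (density L (indicator (snd -` S \<inter> space L))) borel proj" for L
    obtain c where c: "\<And>x. (indicator S x :: complex) = (\<Sum>h\<in>UNIV. c h * gval h x)"
      using indicator_gval[of S] by blast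
    have R: "finite_measure (R L)" "sets (R L) = sets borel" "AE z in R L. cmod z = 1"
      "\<And>k. (LINT z|R L. z powi k) = (\<Sum>h\<in>UNIV. c h * charf L (of_int k * (1 / of_nat n)) h)"
      "emeasure (R L) B = emeasure L X"
      if L: "prob_space L" "sets L = sets X_M" for L
    proof -
      interpret prob_space L by fact
      have space_L: "space L = sol \<times> UNIV" using sets_eq_imp_space_eq[OF L(2)] by simp
      note [measurable_cong] = L(2)
      have S [measurable]: "snd -` S \<inter> space L \<in> sets L"
        using measurable_sets[OF measurable_X_snd, of S] L(2) space_L by simp
      have proj [measurable]: "proj \<in> borel_measurable L" unfolding proj_def by measurable
      have em: "emeasure (R L) A = emeasure L (proj -` A \<inter> space L \<inter> (snd -` S \<inter> space L))"
        if A [measurable]: "A \<in> sets borel" for A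
      proof -
        have P: "proj -` A \<inter> space L \<in> sets L" using proj A by (rule measurable_sets)
        have "emeasure (R L) A = emeasure (density L (indicator (snd -` S \<inter> space L))) (proj -` A \<inter> space L)"
          unfolding R_def by (subst emeasure_distr) auto
        also have "\<dots> = (\<integral>\<^sup>+x. indicator (snd -` S \<inter> space L) x * indicator (proj -` A \<inter> space L) x \<partial>L)"
          using P by (intro emeasure_density) auto
        also have "\<dots> = (\<integral>\<^sup>+x. indicator (proj -` A \<inter> space L \<inter> (snd -` S \<inter> space L)) x \<partial>L)"
          by (intro nn_integral_cong) (auto simp: indicator_def)
        finally show ?thesis using P S by simp
      qed
      show "sets (R L) = sets borel" by (simp add: R_def)
      have "space (R L) = UNIV" by (simp add: R_def)
      then show "finite_measure (R L)"
        by (intro finite_measureI) (simp add: em emeasure_eq_measure)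
      show "emeasure (R L) B = emeasure L X"
        using em[OF X(2)] by (simp add: X(1) X_cylinder_def space_L proj_def)
          (rule arg_cong[where f = "emeasure L"], auto)
      show "AE z in R L. cmod z = 1"
        unfolding R_def
        by (subst AE_distr_iff) (auto simp: AE_density space_L proj_def sol_norm intro!: AE_I2)
      show "(LINT z|R L. z powi k) = (\<Sum>h\<in>UNIV. c h * charf L (of_int k * (1 / of_nat n)) h)" for k
      proof -
        have pm: "(\<lambda>z::complex. z powi k) \<in> borel_measurable borel"
          by (cases "k \<ge> 0") (simp_all add: power_int_def)
        have "(LINT z|R L. z powi k) = (LINT x|density L (indicator (snd -` S \<inter> space L)). proj x powi k)"
          unfolding R_def using pm by (subst integral_distr) auto
        also have "\<dots> = (LINT x|L. indicator (snd -` S \<inter> space L) x *\<^sub>R proj x powi k)"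
          using integral_density[of "\<lambda>x. proj x powi k" L "indicator (snd -` S \<inter> space L)"] pm measurable_compose[OF proj pm]
          by (simp add: ennreal_indicator)
        also have "\<dots> = (LINT x|L. (\<Sum>h\<in>UNIV. c h * (fst x (of_int k * (1 / of_nat n)) * gval h (snd x))))"
        proof (rule Bochner_Integration.integral_cong)
          fix x assume x: "x \<in> space L"
          then have "fst x \<in> sol" using space_L by auto
          then have "proj x powi k = fst x (of_int k * (1 / of_nat n))"
            unfolding proj_def by (simp only: sol_of_int)
          moreover have "indicator (snd -` S \<inter> space L) x *\<^sub>R proj x powi k = indicator S (snd x) * proj x powi k"
            using x by (simp add: indicator_def)
          ultimately show "indicator (snd -` S \<inter> space L) x *\<^sub>R proj x powi k =
              (\<Sum>h\<in>UNIV. c h * (fst x (of_int k * (1 / of_nat n)) * gval h (snd x)))"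
            by (simp add: c sum_distrib_left mult_ac)
        qed simp
        also have "\<dots> = (\<Sum>h\<in>UNIV. c h * charf L (of_int k * (1 / of_nat n)) h)"
          using X_char_integrable[OF L] by (subst Bochner_Integration.integral_sum) (auto simp: charf_def charfun_X_def)
        finally show ?thesis .
      qed
    qed
    have "R \<mu> = R \<nu>"
      by (rule circle_measure_eqI) (use R[OF \<mu>] R[OF \<nu>] eq in auto)
    then show ?thesis using R(5)[OF \<mu>] R(5)[OF \<nu>] by simp
  qed
qed auto

section \<open>Characters of X and the adjoint automorphism\<close>

definition Xchar :: "rat \<Rightarrow> 'g::ab_group_add gchar \<Rightarrow> (rat \<Rightarrow> complex) \<times> 'g \<Rightarrow> complex" where
  "Xchar r h x = fst x r * gval h (snd x)"

lemma charf_Xchar: "charf \<mu> r h = (LINT x|\<mu>. Xchar r h x)"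
  by (simp add: charf_def charfun_X_def Xchar_def)

lemma measurable_Xchar [measurable]: "Xchar r h \<in> borel_measurable X_M"
  unfolding Xchar_def[abs_def] by (rule measurable_X_char)

lemma norm_Xchar: "x \<in> space X_M \<Longrightarrow> cmod (Xchar r h x) = 1"
  by (auto simp: Xchar_def norm_mult sol_norm)

lemma Xchar_xadd: "Xchar r h (xadd x y) = Xchar r h x * Xchar r h y"
  by (simp add: Xchar_def xadd_def gval_add_right)

lemma Xchar_add: "x \<in> space X_M \<Longrightarrow> Xchar (r + s) (h + k) x = Xchar r h x * Xchar s k x"
  by (auto simp: Xchar_def sol_add gval_add)

lemma Xchar_xneg: "Xchar r h (xneg x) = Xchar (- r) (- h) x"
  by (simp add: Xchar_def xneg_def gval_uminus)

lemma Xchar_uminus: "x \<in> space X_M \<Longrightarrow> Xchar (- r) (- h) x = cnj (Xchar r h x)"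
  by (auto simp: Xchar_def sol_uminus gval_uminus gval_uminus_right)

text \<open>The composition is a character only for additive \<open>\<alpha>\<close>, which is why
  the facts about this transposed map assume additivity.\<close>

definition gadj :: "('g::ab_group_add \<Rightarrow> 'g) \<Rightarrow> 'g gchar \<Rightarrow> 'g gchar" where
  "gadj \<alpha> h = Abs_gchar (\<lambda>g. gval h (\<alpha> g))"

lemma gval_gadj:
  assumes "\<And>x y. \<alpha> (x + y) = \<alpha> x + \<alpha> y"
  shows "gval (gadj \<alpha> h) g = gval h (\<alpha> g)"
proof -
  have "g_char (\<lambda>g. gval h (\<alpha> g))" by (simp add: g_char_def assms gval_add_right)
  then show ?thesis by (simp add: gadj_def Abs_gchar_inverse)
qed

lemma gadj_add:
  assumes "\<And>x y. \<alpha> (x + y) = \<alpha> x + \<alpha> y"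
  shows "gadj \<alpha> (h + k) = gadj \<alpha> h + gadj \<alpha> k"
  by (rule gval_eqI) (simp add: gval_gadj[OF assms] gval_add)

lemma gadj_inj:
  assumes "\<And>x y. \<alpha> (x + y) = \<alpha> x + \<alpha> y" "surj \<alpha>"
  shows "inj (gadj \<alpha>)"
proof (rule injI, rule gval_eqI)
  fix h k g assume eq: "gadj \<alpha> h = gadj \<alpha> k"
  obtain g' where "g = \<alpha> g'" using assms(2) by blast
  then show "gval h g = gval k g" using gval_gadj[OF assms(1), of h g'] gval_gadj[OF assms(1), of k g'] eq by simp
qed

text \<open>Doubling is its own adjoint: injective on the finite group \<open>G\<close>, it is
  surjective there, and \<open>gval h (g' + g')\<close> equals
  \<open>gval (h + h) g'\<close>.\<close>

lemma gchar_double_inj: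
  assumes "\<And>g::'g::{ab_group_add, finite}. g + g = 0 \<Longrightarrow> g = 0"
  shows "inj (\<lambda>h::'g gchar. h + h)"
proof (rule injI, rule gval_eqI)
  fix h k :: "'g gchar" and g :: 'g assume eq: "h + h = k + k"
  have "inj (\<lambda>g::'g. g + g)"
  proof (rule injI)
    fix x y :: 'g assume eq: "x + x = y + y"
    have "(x - y) + (x - y) = (x + x) - (y + y)" by (rule add_diff_add[symmetric])
    then have "(x - y) + (x - y) = 0" unfolding eq diff_self .
    from assms[OF this] show "x = y" by simp
  qed
  then have "surj (\<lambda>g::'g. g + g)" by (simp add: finite_UNIV_inj_surj)
  then obtain g' where g: "g = g' + g'" unfolding surj_def by blast
  have "gval h g = gval (h + h) g'" "gval k g = gval (k + k) g'"
    by (simp_all add: g gval_add gval_add_right)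
  then show "gval h g = gval k g" using eq by simp
qed

lemma Xchar_alpha_aut:
  assumes "\<And>x y. \<alpha> (x + y) = \<alpha> x + \<alpha> y"
  shows "Xchar r h (alpha_aut a \<alpha> x) = Xchar (a * r) (gadj \<alpha> h) x"
  by (simp add: Xchar_def alpha_aut_def gval_gadj[OF assms])

section \<open>Characteristic functions of images, convolutions and Gaussians\<close>

lemma charf_distr:
  assumes "f \<in> measurable M X_M"
  shows "charf (distr M X_M f) r h = (LINT x|M. Xchar r h (f x))"
  unfolding charf_Xchar using assms by (subst integral_distr) auto

lemma charf_return: "x \<in> space X_M \<Longrightarrow> charf (return X_M x) r h = Xchar r h x"
  unfolding charf_Xchar by (subst integral_return) auto

lemma measurable_Xchar_compose: "f \<in> measurable M X_M \<Longrightarrow> (\<lambda>x. Xchar r h (f x)) \<in> borel_measurable M"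
  by (rule measurable_compose[OF _ measurable_Xchar])

lemma measurable_xadd:
  "(\<lambda>(x, y). xadd x y) \<in> measurable (X_M \<Otimes>\<^sub>M X_M)
    (X_M :: ((rat \<Rightarrow> complex) \<times> 'g::{ab_group_add, finite}) measure)"
proof (rule measurable_X_MI)
  let ?M = "X_M \<Otimes>\<^sub>M X_M :: (((rat \<Rightarrow> complex) \<times> 'g) \<times> ((rat \<Rightarrow> complex) \<times> 'g)) measure"
  show "fst (case x of (x, y) \<Rightarrow> xadd x y) \<in> sol" if "x \<in> space ?M" for x
    using that by (auto simp: space_pair_measure xadd_def sol_mult)
  have "(\<lambda>x. fst (fst x) r * fst (snd x) r) \<in> borel_measurable ?M" for r
    by (intro borel_measurable_times measurable_compose[OF measurable_fst measurable_X_fst_component]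
        measurable_compose[OF measurable_snd measurable_X_fst_component])
  then show "(\<lambda>x. fst (case x of (x, y) \<Rightarrow> xadd x y) r) \<in> borel_measurable ?M" for r
    by (simp add: xadd_def case_prod_beta)
  have "(\<lambda>x. snd (fst x)) \<in> measurable ?M (count_space UNIV)" "(\<lambda>x. snd (snd x)) \<in> measurable ?M (count_space UNIV)"
    by (rule measurable_compose[OF measurable_fst measurable_X_snd],
        rule measurable_compose[OF measurable_snd measurable_X_snd])
  then have "(\<lambda>x. (snd (fst x), snd (snd x))) \<in> measurable ?M (count_space UNIV \<Otimes>\<^sub>M count_space UNIV)"
    by (rule measurable_Pair)
  \<comment> \<open>Finiteness of \<open>G\<close> enters here: the product of the two discrete
    algebras is discrete, so addition is measurable.\<close>
  moreover have "count_space UNIV \<Otimes>\<^sub>M count_space UNIV = (count_space UNIV :: ('g \<times> 'g) measure)"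
    by (subst pair_measure_count_space) auto
  ultimately have "(\<lambda>x. (snd (fst x), snd (snd x))) \<in> measurable ?M (count_space UNIV)" by simp
  from measurable_compose[OF this, of "\<lambda>(g, h). g + h" "count_space UNIV"]
  show "(\<lambda>x. snd (case x of (x, y) \<Rightarrow> xadd x y)) \<in> measurable ?M (count_space UNIV)"
    by (simp add: xadd_def case_prod_beta)
qed

lemma
  fixes \<mu> \<nu> :: "((rat \<Rightarrow> complex) \<times> 'g::{ab_group_add, finite}) measure"
  assumes \<mu>: "prob_space \<mu>" "sets \<mu> = sets X_M"
    and \<nu>: "prob_space \<nu>" "sets \<nu> = sets X_M"
  shows prob_space_conv_X: "prob_space (conv_X \<mu> \<nu>)"
    and sets_conv_X [simp]: "sets (conv_X \<mu> \<nu>) = sets X_M"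
    and charf_conv_X: "charf (conv_X \<mu> \<nu>) r h = charf \<mu> r h * charf \<nu> r h"
proof -
  interpret M: prob_space \<mu> by fact
  interpret N: prob_space \<nu> by fact
  interpret pair_prob_space \<mu> \<nu> ..
  note sets_pair = sets_pair_measure_cong[OF \<mu>(2) \<nu>(2)]
  have m: "(\<lambda>(x, y). xadd x y) \<in> measurable (\<mu> \<Otimes>\<^sub>M \<nu>) X_M"
    using measurable_xadd sets_pair by (simp cong: measurable_cong_sets)
  show "prob_space (conv_X \<mu> \<nu>)" unfolding conv_X_def by (rule prob_space_distr[OF m])
  show "sets (conv_X \<mu> \<nu>) = sets X_M" by (simp add: conv_X_def)
  have meas: "(\<lambda>(x, y). Xchar r h x * Xchar r h y) \<in> borel_measurable (\<mu> \<Otimes>\<^sub>M \<nu>)"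
    using measurable_compose[OF m measurable_Xchar, of r h] by (simp add: case_prod_beta Xchar_xadd)
  have int: "integrable (\<mu> \<Otimes>\<^sub>M \<nu>) (\<lambda>(x, y). Xchar r h x * Xchar r h y)"
    using meas sets_eq_imp_space_eq[OF \<mu>(2)] sets_eq_imp_space_eq[OF \<nu>(2)]
    by (intro integrable_const_bound[where B = 1] AE_I2)
      (auto simp: space_pair_measure norm_mult norm_Xchar)
  have "charf (conv_X \<mu> \<nu>) r h = (LINT x|(\<mu> \<Otimes>\<^sub>M \<nu>). (case x of (x, y) \<Rightarrow> Xchar r h x * Xchar r h y))"
    unfolding conv_X_def charf_distr[OF m] by (simp add: case_prod_beta Xchar_xadd)
  also have "\<dots> = (LINT x|\<mu>. LINT y|\<nu>. Xchar r h x * Xchar r h y)"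
    using integral_fst'[OF int] by simp
  also have "\<dots> = charf \<mu> r h * charf \<nu> r h"
    by (simp add: charf_Xchar)
  finally show "charf (conv_X \<mu> \<nu>) r h = charf \<mu> r h * charf \<nu> r h" .
qed

lemma
  fixes \<gamma> :: "(rat \<Rightarrow> complex) measure"
  assumes \<gamma>: "prob_space \<gamma>" "sets \<gamma> = sets sol_M"
  defines "\<mu> \<equiv> (embed_sol \<gamma> :: ((rat \<Rightarrow> complex) \<times> 'g::{ab_group_add, finite}) measure)"
  shows prob_space_embed_sol: "prob_space \<mu>"
    and sets_embed_sol: "sets \<mu> = sets X_M"
    and charf_embed_sol: "charf \<mu> r h = charfun_sol \<gamma> r"
proof -
  have "(\<lambda>c. (c, 0)) \<in> measurable sol_M (X_M :: ((rat \<Rightarrow> complex) \<times> 'g) measure)"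
    by (rule measurable_X_MI) simp_all
  then have m: "(\<lambda>c. (c, 0)) \<in> measurable \<gamma> (X_M :: ((rat \<Rightarrow> complex) \<times> 'g) measure)"
    using \<gamma>(2) by (simp cong: measurable_cong_sets)
  show "prob_space \<mu>" unfolding \<mu>_def embed_sol_def by (rule prob_space.prob_space_distr[OF \<gamma>(1) m])
  show "sets \<mu> = sets X_M" by (simp add: \<mu>_def embed_sol_def)
  show "charf \<mu> r h = charfun_sol \<gamma> r"
    unfolding \<mu>_def embed_sol_def charf_distr[OF m] by (simp add: Xchar_def charfun_sol_def)
qed

text \<open>Image of the standard normal law under a one-parameter subgroup of the solenoid; the
  speed \<open>sqrt (2 * \<sigma>)\<close> turns \<open>exp (- t^2 / 2)\<close> into
  \<open>exp (- \<sigma> * r^2)\<close>. Only centred Gaussians are built, as the factor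
  \<open>z\<close> is later absorbed in the point masses.\<close>

lemma ex_gaussian_sol:
  assumes "\<sigma> \<ge> 0"
  shows "\<exists>\<gamma>. gaussian_sol \<gamma> \<and> (\<forall>r. charfun_sol \<gamma> r = exp (complex_of_real (- \<sigma> * (real_of_rat r)\<^sup>2)))"
proof -
  let ?N = std_normal_distribution
  define f where "f x = (\<lambda>r. iexp (sqrt (2 * \<sigma>) * of_rat r * x))" for x :: real
  define \<gamma> where "\<gamma> = distr ?N sol_M f"
  have N: "prob_space ?N" by (rule real_distribution.axioms(1)) (rule real_dist_normal_dist)
  have m: "f \<in> measurable ?N sol_M"
  proof (rule measurable_sol_MI)
    show "f x \<in> sol" for x
      by (simp add: sol_def f_def of_rat_add algebra_simps flip: exp_add)
    show "(\<lambda>x. f x r) \<in> borel_measurable ?N" for r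
      unfolding f_def by measurable
  qed
  have ch: "charfun_sol \<gamma> r = exp (complex_of_real (- \<sigma> * (real_of_rat r)\<^sup>2))" for r
  proof -
    have "charfun_sol \<gamma> r = char ?N (sqrt (2 * \<sigma>) * of_rat r)"
      unfolding charfun_sol_def \<gamma>_def using m
      by (subst integral_distr) (auto simp: f_def char_def)
    also have "\<dots> = complex_of_real (exp (- ((sqrt (2 * \<sigma>) * of_rat r)\<^sup>2) / 2))"
      by (simp add: char_std_normal_distribution)
    also have "- ((sqrt (2 * \<sigma>) * of_rat r)\<^sup>2) / 2 = - \<sigma> * (real_of_rat r)\<^sup>2"
      using assms by (simp add: power_mult_distrib)
    finally show ?thesis by (simp only: exp_of_real)
  qed
  have "prob_space \<gamma>" unfolding \<gamma>_def by (rule prob_space.prob_space_distr[OF N m])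
  moreover have "sets \<gamma> = sets sol_M" by (simp add: \<gamma>_def)
  ultimately have "gaussian_sol \<gamma>"
    unfolding gaussian_sol_def using assms ch sol_one by (auto intro!: bexI[of _ "\<lambda>_. 1"] exI[of _ \<sigma>])
  then show ?thesis using ch by blast
qed

text \<open>The variance of \<open>Y\<close> about its mean \<open>c\<close> is
  \<open>1 - (cmod c)^2\<close>, which vanishes here.\<close>

lemma (in prob_space) AE_eq_expectation:
  fixes Y :: "'a \<Rightarrow> complex"
  assumes Y: "Y \<in> borel_measurable M" "\<And>x. x \<in> space M \<Longrightarrow> cmod (Y x) = 1"
    and one: "cmod (expectation Y) = 1"
  shows "AE x in M. Y x = expectation Y"
proof -
  define c where "c = expectation Y"
  have intY: "integrable M Y"
    using Y by (intro integrable_const_bound[where B = 1]) auto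
  have sq: "(cmod (Y x - c))\<^sup>2 = 2 - 2 * Re (cnj c * Y x)" if "x \<in> space M" for x
  proof -
    have "complex_of_real ((cmod (Y x - c))\<^sup>2) = (Y x - c) * cnj (Y x - c)"
      by (rule complex_norm_square)
    also have "\<dots> = Y x * cnj (Y x) + c * cnj c - (cnj c * Y x + cnj (cnj c * Y x))"
      by (simp add: algebra_simps)
    also have "\<dots> = of_real ((cmod (Y x))\<^sup>2 + (cmod c)\<^sup>2 - 2 * Re (cnj c * Y x))"
      by (simp only: of_real_add of_real_diff complex_norm_square complex_add_cnj)
    finally show ?thesis using Y(2)[OF that] one unfolding of_real_eq_iff c_def by simp
  qed
  have int: "integrable M (\<lambda>x. 2 - 2 * Re (cnj c * Y x))"
    using intY by (intro Bochner_Integration.integrable_diff integrable_mult_right integrable_Re) auto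
  then have int2: "integrable M (\<lambda>x. (cmod (Y x - c))\<^sup>2)"
    by (subst Bochner_Integration.integrable_cong[OF refl sq]) auto
  have "(LINT x|M. (cmod (Y x - c))\<^sup>2) = (LINT x|M. 2 - 2 * Re (cnj c * Y x))"
    by (rule Bochner_Integration.integral_cong[OF refl sq])
  also have "\<dots> = 2 - 2 * Re (cnj c * c)"
    using intY by (simp add: c_def prob_space)
  also have "\<dots> = 0" using one by (simp add: c_def complex_norm_square[symmetric] mult.commute[of "cnj _"])
  finally have "AE x in M. (cmod (Y x - c))\<^sup>2 = 0"
    using int2 by (subst (asm) integral_nonneg_eq_0_iff_AE) auto
  then show ?thesis by (simp add: c_def)
qed

section \<open>Heyde's functional equation\<close>

text \<open>Heyde's equation in moduli, with rational arguments 0: \<open>eq1\<close> comes from the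
  pair \<open>u, u\<close> and \<open>eq2\<close> from the pair \<open>b u, u\<close>, each making
  one of the four arguments zero. The sign of \<open>b u - u\<close> disappears because the moduli
  are even.\<close>

locale heyde_moduli =
  fixes m1 m2 :: "'h::{ab_group_add, finite} \<Rightarrow> real" and b :: "'h \<Rightarrow> 'h"
  assumes pos: "m1 h > 0" "m2 h > 0" and le_one: "m1 h \<le> 1" "m2 h \<le> 1"
    and b_add: "b (h + k) = b h + b k" and b_inj: "inj b"
    and double_inj: "inj (\<lambda>h::'h. h + h)"
    and eq1: "m1 (u + u) * m2 (u + b u) = m2 (u - b u)"
    and eq2: "m2 (b u + b u) * m1 (u + b u) = m1 (u - b u)"
begin

definition s where "s h = h - b h"

lemma b_zero: "b 0 = 0"
  using b_add[of 0 0] by simp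

lemma b_minus: "b (- h) = - b h"
  using b_add[of h "- h"] b_zero by (simp add: add_eq_0_iff)

lemma b_diff: "b (h - k) = b h - b k"
  using b_add[of h "- k"] by (simp add: b_minus)

lemma s_add: "s (h + k) = s h + s k"
  by (simp add: s_def b_add)

lemma s_pow_add: "(s ^^ n) (h + k) = (s ^^ n) h + (s ^^ n) k"
  by (induction n) (simp_all add: s_add)

lemma s_b: "s (b h) = b (s h)"
  by (simp add: s_def b_diff)

lemma s_pow_b: "(s ^^ n) (b h) = b ((s ^^ n) h)"
  by (induction n) (simp_all add: s_b)

lemma bij_b: "bij b" and bij_double: "bij (\<lambda>h::'h. h + h)"
  using b_inj double_inj by (simp_all add: bij_def finite_UNIV_inj_surj)

lemma bij_double_b: "bij (\<lambda>h. b (h + h))"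
  using bij_comp[OF bij_double bij_b] by (simp add: comp_def)

lemma ln_eq1: "ln (m1 (u + u)) + ln (m2 (u + b u)) = ln (m2 (s u))"
  using eq1[of u] pos by (metis ln_mult_pos s_def)

lemma ln_eq2: "ln (m2 (b (u + u))) + ln (m1 (u + b u)) = ln (m1 (s u))"
  using eq2[of u] pos by (metis ln_mult_pos s_def b_add)

text \<open>The sum of \<open>ln m1 + ln m2\<close> over the points \<open>(I - b)^n y\<close> decreases with \<open>n\<close> by the sum of
  the nonnegative terms \<open>- ln m1 - ln m2\<close> at the points \<open>(I + b) (I - b)^n y\<close>; since the powers of
  \<open>I - b\<close> are eventually periodic, these terms vanish for some \<open>n\<close>.\<close>

lemma ex_power_moduli_one: "\<exists>n. \<forall>y. m1 ((s ^^ n) y + b ((s ^^ n) y)) = 1 \<and> m2 ((s ^^ n) y + b ((s ^^ n) y)) = 1"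
proof -
  define T where "T n = (\<Sum>y\<in>UNIV. ln (m1 ((s ^^ n) y)) + ln (m2 ((s ^^ n) y)))" for n
  define D where "D n = (\<Sum>y\<in>UNIV. ln (m1 ((s ^^ n) y + b ((s ^^ n) y))) + ln (m2 ((s ^^ n) y + b ((s ^^ n) y))))" for n
  have step: "T n + D n = T (Suc n)" for n
  proof -
    have "T n = (\<Sum>y\<in>UNIV. ln (m1 ((s ^^ n) y))) + (\<Sum>y\<in>UNIV. ln (m2 ((s ^^ n) y)))"
      by (simp add: T_def sum.distrib)
    \<comment> \<open>Doubling, alone or followed by \<open>b\<close>, is a bijection of the group;
      reindexing by these maps produces the first factors of \<open>eq1\<close> and
      \<open>eq2\<close>.\<close>
    also have "(\<Sum>y\<in>UNIV. ln (m1 ((s ^^ n) y))) = (\<Sum>y\<in>UNIV. ln (m1 ((s ^^ n) (y + y))))"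
      using sum.reindex_bij_betw[OF bij_double, of "\<lambda>y. ln (m1 ((s ^^ n) y))"] by simp
    also have "(\<Sum>y\<in>UNIV. ln (m2 ((s ^^ n) y))) = (\<Sum>y\<in>UNIV. ln (m2 ((s ^^ n) (b (y + y)))))"
      using sum.reindex_bij_betw[OF bij_double_b, of "\<lambda>y. ln (m2 ((s ^^ n) y))"] by simp
    finally have "T n + D n = (\<Sum>y\<in>UNIV.
        (ln (m1 ((s ^^ n) y + (s ^^ n) y)) + ln (m2 ((s ^^ n) y + b ((s ^^ n) y)))) +
        (ln (m2 (b ((s ^^ n) y + (s ^^ n) y))) + ln (m1 ((s ^^ n) y + b ((s ^^ n) y)))))"
      by (simp add: D_def sum.distrib s_pow_add s_pow_b)
    also have "\<dots> = T (Suc n)"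
      unfolding ln_eq1 ln_eq2 by (simp add: T_def add.commute)
    finally show ?thesis .
  qed
  have terms: "ln (m1 h) \<le> 0" "ln (m2 h) \<le> 0" for h
    using pos le_one by simp_all
  then have nonneg: "0 \<le> - (ln (m1 h) + ln (m2 h))" for h
    by (metis add_nonpos_nonpos neg_0_le_iff_le)
  have D: "D n \<le> 0" for n
    unfolding D_def using terms by (intro sum_nonpos add_nonpos_nonpos) auto
  have "\<not> inj (\<lambda>n. s ^^ n)"
    using finite_imageD[of "\<lambda>n. s ^^ n" UNIV] by (metis finite infinite_UNIV_nat)
  then obtain i j where ij: "i < j" "s ^^ i = s ^^ j"
    unfolding inj_def by (metis linorder_neqE_nat)
  then have "T i = T j" by (simp add: T_def)
  moreover have "T j \<le> T (Suc i)"
  proof (rule lift_Suc_antimono_le[of T])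
    show "T (Suc n) \<le> T n" for n using step[of n] D[of n] by linarith
    show "Suc i \<le> j" using ij by simp
  qed
  ultimately have "D i = 0" using step[of i] D[of i] by linarith
  then have "(\<Sum>y\<in>UNIV. - (ln (m1 ((s ^^ i) y + b ((s ^^ i) y))) + ln (m2 ((s ^^ i) y + b ((s ^^ i) y))))) = 0"
    unfolding D_def sum_negf by simp
  then have "\<forall>y\<in>UNIV. - (ln (m1 ((s ^^ i) y + b ((s ^^ i) y))) + ln (m2 ((s ^^ i) y + b ((s ^^ i) y)))) = 0"
    by (rule iffD1[OF sum_nonneg_eq_0_iff[OF finite nonneg]])
  then have "ln (m1 ((s ^^ i) y + b ((s ^^ i) y))) = 0 \<and> ln (m2 ((s ^^ i) y + b ((s ^^ i) y))) = 0" for y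
    using terms[of "(s ^^ i) y + b ((s ^^ i) y)"] by (smt (verit) UNIV_I)
  then show ?thesis using pos by (intro exI[of _ i]) simp
qed

text \<open>At \<open>u = (I + b) (I - b)^n x\<close> the right-hand sides of \<open>eq1\<close> and
  \<open>eq2\<close> are one by assumption, and a product of two numbers in \<open>(0, 1]\<close> is
  one only if both are. Since doubling, alone or followed by \<open>b\<close>, is surjective, the
  arguments of the first factors exhaust the image of \<open>(I + b) (I - b)^n\<close>.\<close>

lemma moduli_one_descend:
  assumes "\<And>y. m1 ((s ^^ Suc n) y + b ((s ^^ Suc n) y)) = 1"
    and "\<And>y. m2 ((s ^^ Suc n) y + b ((s ^^ Suc n) y)) = 1"
  shows "m1 ((s ^^ n) y + b ((s ^^ n) y)) = 1 \<and> m2 ((s ^^ n) y + b ((s ^^ n) y)) = 1"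
proof -
  have mul: "x = 1" if "x * y = 1" "0 < x" "x \<le> 1" "0 < y" "y \<le> 1" for x y :: real
    using that mult_left_mono[of y 1 x] by simp
  have s_out: "s ((s ^^ n) x + b ((s ^^ n) x)) = (s ^^ Suc n) x + b ((s ^^ Suc n) x)" for x
    by (simp add: s_add s_b)
  obtain y1 where y1: "y = y1 + y1" using bij_double unfolding bij_def surj_def by blast
  obtain y2 where y2: "y = b (y2 + y2)" using bij_double_b unfolding bij_def surj_def by blast
  let ?u = "\<lambda>x. (s ^^ n) x + b ((s ^^ n) x)"
  have "m1 (?u y1 + ?u y1) * m2 (?u y1 + b (?u y1)) = 1"
    using eq1[of "?u y1"] unfolding s_def[symmetric] s_out assms(2) .
  then have "m1 (?u y1 + ?u y1) = 1"
    by (rule mul[OF _ pos(1) le_one(1) pos(2) le_one(2)])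
  moreover have "?u y1 + ?u y1 = ?u y"
    by (simp add: y1 s_pow_add b_add)
  moreover have "m2 (b (?u y2) + b (?u y2)) * m1 (?u y2 + b (?u y2)) = 1"
    using eq2[of "?u y2"] unfolding s_def[symmetric] s_out assms(1) .
  then have "m2 (b (?u y2) + b (?u y2)) = 1"
    by (rule mul[OF _ pos(2) le_one(2) pos(1) le_one(1)])
  moreover have "b (?u y2) + b (?u y2) = ?u y"
    by (simp add: y2 s_pow_add s_pow_b b_add add_ac)
  ultimately show ?thesis by simp
qed

lemma moduli_one: "m1 (h + b h) = 1" "m2 (h + b h) = 1"
proof -
  have "m1 (h + b h) = 1 \<and> m2 (h + b h) = 1"
    if "\<forall>y. m1 ((s ^^ n) y + b ((s ^^ n) y)) = 1 \<and> m2 ((s ^^ n) y + b ((s ^^ n) y)) = 1" for n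
    using that
  proof (induction n)
    case (Suc n)
    then show ?case using moduli_one_descend[of n] by blast
  qed simp
  then show "m1 (h + b h) = 1" "m2 (h + b h) = 1" using ex_power_moduli_one by blast+
qed

end

text \<open>Each of the first two substitutions removes one of the four factors of the equation, and the last
  choice of \<open>v\<close> freezes another.\<close>

lemma heyde_second_difference_const:
  fixes f1 f2 :: "rat \<Rightarrow> complex"
  assumes nz: "\<And>r. f1 r \<noteq> 0" "\<And>r. f2 r \<noteq> 0"
    and eq: "\<And>u v. f1 (u + v) * f2 (u + a * v) = f1 (u - v) * f2 (u - a * v)"
    and a: "a \<noteq> 0" "a \<noteq> 1" "a \<noteq> -1"
  shows "f1 (x + h + k) * f1 x / (f1 (x + h) * f1 (x + k)) = f1 (h + k) * f1 0 / (f1 h * f1 k)"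
proof -
  \<comment> \<open>Shifting \<open>u\<close> by \<open>a * k'\<close> and \<open>v\<close> by
    \<open>k'\<close> fixes \<open>u - a * v\<close> and moves \<open>u + v\<close> by
    \<open>k\<close>.\<close>
  define k' where "k' = k / (a + 1)"
  \<comment> \<open>Shifting both \<open>u\<close> and \<open>v\<close> by \<open>h / 2\<close>
    fixes \<open>u - v\<close> and moves \<open>u + v\<close> by \<open>h\<close>.\<close>
  define l where "l = h / 2"
  have "a + 1 \<noteq> 0" using a(3) by (simp add: eq_neg_iff_add_eq_0)
  then have k': "a * k' + k' = k" unfolding k'_def
    by (metis distrib_right mult_1 nonzero_mult_div_cancel_left times_divide_eq_right)
  have l: "l + l = h" unfolding l_def by simp
  define p1 where "p1 x = f1 (x + k) / f1 x" for x
  define p2 where "p2 x = f2 (x + 2 * a * k') / f2 x" for x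
  define p3 where "p3 x = f1 (x + (a - 1) * k') / f1 x" for x
  have 1: "p1 (u + v) * p2 (u + a * v) = p3 (u - v)" for u v
  proof -
    have "f1 (u + v + k) * f2 (u + a * v + 2 * a * k') = f1 (u - v + (a - 1) * k') * f2 (u - a * v)"
    proof -
      have "u + a * k' + (v + k') = u + v + k" unfolding k'[symmetric] by (simp add: algebra_simps)
      moreover have "u + a * k' - (v + k') = u - v + (a - 1) * k'"
        "u + a * k' + a * (v + k') = u + a * v + 2 * a * k'"
        "u + a * k' - a * (v + k') = u - a * v" by (simp_all add: algebra_simps)
      ultimately show ?thesis using eq[of "u + a * k'" "v + k'"] by metis
    qed
    then show ?thesis
      using eq[of u v] nz unfolding p1_def p2_def p3_def
      by (simp add: divide_simps)
  qed
  have nzp: "p1 x \<noteq> 0" "p2 x \<noteq> 0" "p3 x \<noteq> 0" for x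
    unfolding p1_def p2_def p3_def using nz by auto
  define q1 where "q1 x = p1 (x + h) / p1 x" for x
  define q2 where "q2 x = p2 (x + l + a * l) / p2 x" for x
  have 2: "q1 (u + v) * q2 (u + a * v) = 1" for u v
  proof -
    have "p1 (u + v + h) * p2 (u + a * v + l + a * l) = p3 (u - v)"
    proof -
      have "u + l + (v + l) = u + v + h" unfolding l[symmetric] by (simp add: algebra_simps)
      moreover have "u + l - (v + l) = u - v" "u + l + a * (v + l) = u + a * v + l + a * l"
        by (simp_all add: algebra_simps)
      ultimately show ?thesis using 1[of "u + l" "v + l"] by metis
    qed
    then show ?thesis using 1[of u v] nzp unfolding q1_def q2_def by (simp add: divide_simps)
  qed
  have const: "q1 x = 1 / q2 0" for x
  proof -
    \<comment> \<open>With \<open>u = - a * v\<close> the argument of \<open>q2\<close> is 0 while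
      \<open>u + v = x\<close>.\<close>
    define v where "v = x / (1 - a)"
    have "(1 - a) * v = x" unfolding v_def using a(2) by simp
    then have "- a * v + v = x" by (simp add: algebra_simps)
    then have "q1 x * q2 0 = 1" using 2[of "- a * v" v] by simp
    then show ?thesis by (metis mult_eq_0_iff nonzero_eq_divide_eq zero_neq_one)
  qed
  have q1: "q1 x = f1 (x + h + k) * f1 x / (f1 (x + h) * f1 (x + k))" for x
    unfolding q1_def p1_def by simp
  show ?thesis using q1[of x] q1[of 0] const[of x] const[of 0] by simp
qed

section \<open>Gaussian form on the rationals\<close>

lemma additive_rat_linear:
  fixes f :: "rat \<Rightarrow> real"
  assumes add: "\<And>x y. f (x + y) = f x + f y"
  shows "f r = f 1 * of_rat r"
proof -
  have zero: "f 0 = 0" using add[of 0 0] by simp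
  have neg: "f (- x) = - f x" for x using add[of x "- x"] zero by simp
  have nat: "f (of_nat n * x) = of_nat n * f x" for n x
    by (induction n) (simp_all add: zero add distrib_right)
  have int: "f (of_int k * x) = of_int k * f x" for k x
    using nat[of "nat \<bar>k\<bar>" x] neg[of "of_nat (nat \<bar>k\<bar>) * x"] by (cases "k \<ge> 0") auto
  obtain p q where r: "r = of_int p / of_int q" "q > 0"
    by (metis quotient_of_denom_pos quotient_of_div surj_pair)
  have "of_int q * f r = of_int p * f 1"
    using int[of q r] int[of p 1] r by simp
  then have "f r = of_int p * f 1 / of_int q" using r(2) by (simp add: field_simps)
  moreover have "real_of_rat r = of_int p / of_int q" by (simp add: r(1) of_rat_divide)
  ultimately show ?thesis by simp
qed

text \<open>\<open>B\<close> measures how far \<open>f1\<close> is from a character. Constant second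
  differences make it multiplicative in each variable, so on the rationals its logarithm is a
  bilinear form \<open>c * r * s\<close>, and the values at \<open>s = - r\<close> recover the
  modulus of \<open>f1\<close>.\<close>

lemma heyde_gaussian_form:
  fixes f1 f2 :: "rat \<Rightarrow> complex"
  assumes nz: "\<And>r. f1 r \<noteq> 0" "\<And>r. f2 r \<noteq> 0"
    and eq: "\<And>u v. f1 (u + v) * f2 (u + a * v) = f1 (u - v) * f2 (u - a * v)"
    and a: "a \<noteq> 0" "a \<noteq> 1" "a \<noteq> -1"
    and f1: "f1 0 = 1" "\<And>r. f1 (- r) = cnj (f1 r)" "\<And>r. cmod (f1 r) \<le> 1"
  shows "\<exists>z \<sigma>. (\<forall>r. cmod (z r) = 1) \<and> (\<forall>r s. z (r + s) = z r * z s) \<and> \<sigma> \<ge> 0 \<and>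
    (\<forall>r. f1 r = z r * exp (complex_of_real (- \<sigma> * (real_of_rat r)\<^sup>2)))"
proof -
  define B where "B h k = f1 (h + k) / (f1 h * f1 k)" for h k
  have B: "f1 (x + h + k) * f1 x = B h k * (f1 (x + h) * f1 (x + k))" for x h k
    using heyde_second_difference_const[OF nz eq a, of x h k] nz
    by (simp add: B_def f1(1) field_simps)
  have B0: "f1 (h + k) = B h k * (f1 h * f1 k)" for h k using B[of 0 h k] by (simp add: f1(1))
  have Bnz: "B h k \<noteq> 0" for h k unfolding B_def using nz by simp
  have sym: "B h k = B k h" for h k by (simp add: B_def add.commute mult.commute)
  \<comment> \<open>The product \<open>f1 (h' + h + k) * f1 h'\<close> is evaluated twice: through
    \<open>B (h + h') k\<close>, and through the second difference at the base point
    \<open>h'\<close>.\<close>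
  have biadd: "B (h + h') k = B h k * B h' k" for h h' k
  proof -
    have "B (h + h') k * (f1 (h + h') * f1 k) * f1 h' = f1 (h' + h + k) * f1 h'"
      using B0[of "h + h'" k] by (simp only: add.commute[of h' h])
    also have "\<dots> = B h k * (f1 (h + h') * (B h' k * (f1 h' * f1 k)))"
      unfolding B[of h' h k] by (simp only: B0[of h' k] add.commute[of h' h])
    finally have "B (h + h') k * (f1 (h + h') * f1 k * f1 h') = B h k * B h' k * (f1 (h + h') * f1 k * f1 h')"
      by (simp only: mult_ac)
    then show ?thesis using nz by simp
  qed
  \<comment> \<open>\<open>f1 (-r)\<close> is conjugate to \<open>f1 r\<close>, so \<open>B\<close> is real; a square on the 2-divisible rationals, it is
    positive, so the phase of \<open>f1\<close> is additive and only the modulus carries the quadratic part.\<close>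
  have real: "cnj (B h k) = B h k" for h k
  proof -
    have "cnj (B h k) = B (- h) (- k)" by (simp add: B_def f1(2)[symmetric] add.commute)
    moreover have "B (- h) (- k) * B h (- k) = B 0 (- k)" using biadd[of "- h" h "- k"] by simp
    moreover have "B h (- k) * B h k = B h 0"
      using biadd[of "- k" k h] by (simp add: sym)
    moreover have "B 0 x = 1" "B x 0 = 1" for x using nz by (simp_all add: B_def f1(1))
    ultimately show ?thesis using Bnz by (metis mult.commute mult_right_cancel)
  qed
  define \<beta> where "\<beta> h k = Re (B h k)" for h k
  have B\<beta>: "B h k = of_real (\<beta> h k)" for h k
    using real[of h k] by (metis Reals_cnj_iff \<beta>_def of_real_Re)
  have \<beta>pos: "\<beta> h k > 0" for h k
  proof -
    have "B h k = B (h / 2) k * B (h / 2) k" using biadd[of "h / 2" "h / 2" k] by simp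
    then have "\<beta> h k = \<beta> (h / 2) k * \<beta> (h / 2) k" unfolding B\<beta> by (metis of_real_eq_iff of_real_mult)
    then have "\<beta> h k \<ge> 0" by simp
    then show ?thesis using Bnz[of h k] B\<beta>[of h k] by force
  qed
  define z where "z r = f1 r / of_real (cmod (f1 r))" for r
  have z1: "cmod (z r) = 1" for r using nz by (simp add: z_def norm_divide)
  have cm: "cmod (f1 (r + s)) = \<beta> r s * (cmod (f1 r) * cmod (f1 s))" for r s
    using \<beta>pos[of r s] by (simp add: B0 B\<beta> norm_mult)
  have z2: "z (r + s) = z r * z s" for r s
    using \<beta>pos[of r s] nz by (simp add: z_def cm) (simp add: B0 B\<beta>)
  define c where "c = ln (\<beta> 1 1)"
  have lin1: "ln (\<beta> (x + y) k) = ln (\<beta> x k) + ln (\<beta> y k)" for x y k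
  proof -
    have "\<beta> (x + y) k = \<beta> x k * \<beta> y k" using biadd[of x y k] unfolding B\<beta> by (metis of_real_eq_iff of_real_mult)
    then show ?thesis using \<beta>pos by (simp add: ln_mult_pos)
  qed
  have \<beta>sym: "\<beta> h k = \<beta> k h" for h k by (simp add: \<beta>_def sym)
  have ln\<beta>: "ln (\<beta> r s) = c * of_rat r * of_rat s" for r s
  proof -
    have "ln (\<beta> r s) = ln (\<beta> 1 s) * of_rat r"
      by (rule additive_rat_linear) (rule lin1)
    moreover have "ln (\<beta> s 1) = ln (\<beta> 1 1) * of_rat s"
      by (rule additive_rat_linear) (rule lin1)
    ultimately show ?thesis by (simp add: c_def \<beta>sym)
  qed
  have mod: "ln (cmod (f1 r)) = (c / 2) * (of_rat r)\<^sup>2" for r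
  proof -
    \<comment> \<open>At \<open>s = - r\<close> the sum is 0, where \<open>f1\<close> is 1, and both
      moduli agree; hence the factor one half. It leads to \<open>\<sigma> = - c / 2\<close>,
      nonnegative because \<open>cmod (f1 1) \<le> 1\<close>.\<close>
    have "1 = \<beta> r (- r) * (cmod (f1 r) * cmod (f1 r))" using cm[of r "- r"] f1 by simp
    then have "ln 1 = ln (\<beta> r (- r)) + (ln (cmod (f1 r)) + ln (cmod (f1 r)))"
      using \<beta>pos nz by (metis ln_mult_pos mult_pos_pos zero_less_norm_iff)
    then show ?thesis by (simp add: ln\<beta> of_rat_minus power2_eq_square)
  qed
  have "ln (cmod (f1 1)) \<le> 0" using f1(3)[of 1] nz by simp
  then have "c \<le> 0" using mod[of 1] by simp
  moreover have "f1 r = z r * exp (complex_of_real (- (- c / 2) * (real_of_rat r)\<^sup>2))" for r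
  proof -
    have "exp (- (- c / 2) * (real_of_rat r)\<^sup>2) = cmod (f1 r)"
      using mod[of r] nz by (metis exp_ln minus_divide_left minus_minus zero_less_norm_iff)
    then have "exp (complex_of_real (- (- c / 2) * (real_of_rat r)\<^sup>2)) = of_real (cmod (f1 r))"
      by (simp only: exp_of_real)
    then show ?thesis using nz by (simp only: z_def) simp
  qed
  ultimately show ?thesis using z1 z2 by (intro exI[of _ z] exI[of _ "- c / 2"]) auto
qed

text \<open>Modulo the image of \<open>I + b\<close> the adjoint \<open>b\<close> acts as \<open>-I\<close>, which makes the arguments \<open>h + k\<close>
  and \<open>h - k\<close> of the two functions independent of each other.\<close>

lemma heyde_invariant_separated:
  fixes F1 F2 :: "rat \<Rightarrow> 'h::ab_group_add \<Rightarrow> complex"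
  assumes eq: "\<And>r s h k. F1 (r + s) (h + k) * F2 (r + a * s) (h + b k) = F1 (r - s) (h - k) * F2 (r - a * s) (h - b k)"
    and inv: "\<And>r h k. F2 r (h + (k + b k)) = F2 r h"
    and double: "bij (\<lambda>h::'h. h + h)"
  shows "F1 (r + s) p * F2 (r + a * s) q = F1 (r - s) q * F2 (r - a * s) p"
proof -
  \<comment> \<open>\<open>h\<close> and \<open>k\<close> are the half sum and the half difference
    of \<open>p\<close> and \<open>q\<close>.\<close>
  obtain h where h: "p + q = h + h" using double unfolding bij_def surj_def by blast
  obtain k where k: "p - q = k + k" using double unfolding bij_def surj_def by blast
  have half: "x = y" if "x + x = y + y" for x y :: 'h
    using double that unfolding bij_def inj_def by blast
  have "(h + k) + (h + k) = (p + q) + (p - q)" unfolding h k by (simp add: algebra_simps)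
  also have "\<dots> = p + p" by simp
  finally have p: "h + k = p" by (rule half)
  have "(h - k) + (h - k) = (p + q) - (p - q)" unfolding h k by (simp add: algebra_simps)
  also have "\<dots> = q + q" by simp
  finally have q: "h - k = q" by (rule half)
  \<comment> \<open>\<open>h + b k\<close> differs from \<open>h - k = q\<close> by
    \<open>k + b k\<close>, and so does \<open>h + k = p\<close> from
    \<open>h - b k\<close>.\<close>
  have 1: "F2 x (h + b k) = F2 x q" for x
    using inv[of x "h - k" k] unfolding q[symmetric] by (simp add: algebra_simps)
  have 2: "F2 x (h - b k) = F2 x p" for x
    using inv[of x "h - b k" k] unfolding p[symmetric] by (simp add: algebra_simps)
  show ?thesis using eq[of r s h k] unfolding p q 1 2 .
qed

text \<open>The rational arguments \<open>a * s, s\<close> freeze the last factor at the rational 0,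
  so comparing general \<open>p\<close> with \<open>p = 0\<close> isolates the dependence on
  \<open>p\<close>; \<open>(1 + a) * s\<close> reaches every rational since
  \<open>a \<noteq> -1\<close>. For \<open>F2\<close> the arguments \<open>- s, s\<close> freeze the
  first factor instead.\<close>

lemma heyde_separated_split:
  fixes F1 F2 :: "rat \<Rightarrow> 'h::zero \<Rightarrow> complex"
  assumes sep: "\<And>r s p q. F1 (r + s) p * F2 (r + a * s) q = F1 (r - s) q * F2 (r - a * s) p"
    and nz: "\<And>r h. F1 r h \<noteq> 0" "\<And>r h. F2 r h \<noteq> 0"
    and one: "F1 0 0 = 1" "F2 0 0 = 1"
    and a: "a \<noteq> -1"
  shows "F1 r p = F1 r 0 * F2 0 p" "F2 r p = F2 r 0 * F2 0 p"
proof -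
  have a1: "1 + a \<noteq> 0" using a by (metis add.commute eq_neg_iff_add_eq_0)
  have 1: "F1 r p = F1 r 0 * F2 0 p" for r p
  proof -
    define s where "s = r / (1 + a)"
    have r: "a * s + s = r" using a1 unfolding s_def
      by (metis add.commute distrib_right mult_1 nonzero_mult_div_cancel_left times_divide_eq_right)
    have "F1 r p * F2 (a * s + a * s) 0 = F1 (a * s - s) 0 * F2 0 p"
      using sep[of "a * s" s p 0] unfolding r by simp
    moreover have "F1 r 0 * F2 (a * s + a * s) 0 = F1 (a * s - s) 0"
      using sep[of "a * s" s 0 0] one unfolding r by simp
    ultimately have "F1 r p * F2 (a * s + a * s) 0 = F1 r 0 * F2 0 p * F2 (a * s + a * s) 0"
      by (simp add: mult_ac)
    then show ?thesis using nz by simp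
  qed
  have F0: "F1 0 p = F2 0 p" for p using 1[of 0 p] one by simp
  show "F1 r p = F1 r 0 * F2 0 p" by (rule 1)
  define s where "s = - r / (1 + a)"
  have "a * s + s = - r" using a1 unfolding s_def
    by (metis add.commute distrib_right mult_1 nonzero_mult_div_cancel_left times_divide_eq_right)
  then have r: "- s - a * s = r" by (simp add: algebra_simps eq_neg_iff_add_eq_0)
  have "F1 (- s - s) 0 * F2 r p = F2 0 p * F2 (- s + a * s) 0"
    using sep[of "- s" s p 0] F0 unfolding r by simp
  also have "F2 (- s + a * s) 0 = F1 (- s - s) 0 * F2 r 0"
    using sep[of "- s" s 0 0] one unfolding r by simp
  finally have "F1 (- s - s) 0 * F2 r p = F1 (- s - s) 0 * (F2 r 0 * F2 0 p)"
    by (simp only: mult_ac)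
  then show "F2 r p = F2 r 0 * F2 0 p" using nz by simp
qed

text \<open>Equal rational arguments \<open>r / 2\<close> together with \<open>q = 0\<close> reduce
  two of the four factors to 1.\<close>

lemma heyde_separated_eq:
  fixes F1 F2 :: "rat \<Rightarrow> 'h::zero \<Rightarrow> complex"
  assumes sep: "\<And>r s p q. F1 (r + s) p * F2 (r - s) q = F1 (r - s) q * F2 (r + s) p"
    and one: "F1 0 0 = 1" "F2 0 0 = 1"
  shows "F1 r p = F2 r p"
  using sep[of "r / 2" "r / 2" p 0] one by simp

section \<open>Independent random variables with symmetric conditional distribution\<close>

lemma pair_distr_LINT_eq:
  assumes eq: "distr P (X_M \<Otimes>\<^sub>M X_M) F = distr P (X_M \<Otimes>\<^sub>M X_M) G"
    and meas: "F \<in> measurable P (X_M \<Otimes>\<^sub>M X_M)" "G \<in> measurable P (X_M \<Otimes>\<^sub>M X_M)"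
  shows "(LINT w|P. Xchar r h (fst (F w)) * Xchar s k (snd (F w))) = (LINT w|P. Xchar r h (fst (G w)) * Xchar s k (snd (G w)))"
proof -
  let ?u = "\<lambda>x. Xchar r h (fst x) * Xchar s k (snd x)"
  have m: "?u \<in> borel_measurable (X_M \<Otimes>\<^sub>M X_M)"
    by (intro borel_measurable_times measurable_compose[OF measurable_fst measurable_Xchar]
        measurable_compose[OF measurable_snd measurable_Xchar])
  have "(LINT w|P. ?u (F w)) = (LINT x|distr P (X_M \<Otimes>\<^sub>M X_M) F. ?u x)"
    by (rule integral_distr[OF meas(1) m, symmetric])
  also have "\<dots> = (LINT w|P. ?u (G w))"
    unfolding eq by (rule integral_distr[OF meas(2) m])
  finally show ?thesis .
qed

lemma xneg_closed: "x \<in> space X_M \<Longrightarrow> xneg x \<in> space X_M"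
  by (cases x) (use sol_scale[of "fst x" "-1"] in \<open>auto simp: xneg_def\<close>)

lemma alpha_aut_closed: "x \<in> space X_M \<Longrightarrow> alpha_aut a \<alpha> x \<in> space X_M"
  by (auto simp: alpha_aut_def sol_scale)

lemma measurable_xadd_pair:
  fixes f g :: "'o \<Rightarrow> (rat \<Rightarrow> complex) \<times> 'g::{ab_group_add, finite}"
  assumes "f \<in> measurable M X_M" "g \<in> measurable M X_M"
  shows "(\<lambda>x. xadd (f x) (g x)) \<in> measurable M X_M"
  using measurable_compose[OF measurable_Pair[OF assms] measurable_xadd] by simp

lemma measurable_xneg: "xneg \<in> measurable X_M (X_M :: ((rat \<Rightarrow> complex) \<times> 'g::{ab_group_add, finite}) measure)"
proof (rule measurable_X_MI)
  show "fst (xneg x) \<in> sol" if "x \<in> space X_M" for x :: "(rat \<Rightarrow> complex) \<times> 'g"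
    using xneg_closed[OF that] by auto
  show "(\<lambda>x :: (rat \<Rightarrow> complex) \<times> 'g. fst (xneg x) r) \<in> borel_measurable X_M" for r
    by (simp add: xneg_def)
  show "(\<lambda>x :: (rat \<Rightarrow> complex) \<times> 'g. snd (xneg x)) \<in> measurable X_M (count_space UNIV)"
    by (simp add: xneg_def measurable_compose[OF measurable_X_snd])
qed

lemma measurable_alpha_aut:
  "alpha_aut a \<alpha> \<in> measurable X_M (X_M :: ((rat \<Rightarrow> complex) \<times> 'g::{ab_group_add, finite}) measure)"
proof (rule measurable_X_MI)
  show "fst (alpha_aut a \<alpha> x) \<in> sol" if "x \<in> space X_M" for x :: "(rat \<Rightarrow> complex) \<times> 'g"
    using alpha_aut_closed[OF that, of a \<alpha>] by auto
  show "(\<lambda>x :: (rat \<Rightarrow> complex) \<times> 'g. fst (alpha_aut a \<alpha> x) r) \<in> borel_measurable X_M" for r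
    by (simp add: alpha_aut_def)
  show "(\<lambda>x :: (rat \<Rightarrow> complex) \<times> 'g. snd (alpha_aut a \<alpha> x)) \<in> measurable X_M (count_space UNIV)"
    by (simp add: alpha_aut_def measurable_compose[OF measurable_X_snd])
qed

section \<open>Characteristic functions of random variables in X\<close>

context prob_space
begin

lemma charf_distr_zero:
  assumes "\<xi> \<in> measurable M X_M"
  shows "charf (distr M X_M \<xi>) 0 0 = 1"
proof -
  have "(LINT w|M. Xchar 0 0 (\<xi> w)) = (LINT w|M. 1)"
    using measurable_space[OF assms] by (intro Bochner_Integration.integral_cong) (auto simp: Xchar_def sol_zero mem_Times_iff)
  then show ?thesis by (simp add: charf_distr[OF assms] prob_space)
qed

lemma charf_distr_uminus:
  assumes "\<xi> \<in> measurable M X_M"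
  shows "charf (distr M X_M \<xi>) (- r) (- h) = cnj (charf (distr M X_M \<xi>) r h)"
proof -
  have "(LINT w|M. Xchar (- r) (- h) (\<xi> w)) = (LINT w|M. cnj (Xchar r h (\<xi> w)))"
    using measurable_space[OF assms] by (intro Bochner_Integration.integral_cong) (auto simp: Xchar_uminus)
  then show ?thesis by (simp add: charf_distr[OF assms])
qed

lemma integrable_Xchar_compose:
  assumes "\<xi> \<in> measurable M X_M"
  shows "integrable M (\<lambda>w. Xchar r h (\<xi> w))"
  using measurable_space[OF assms] measurable_Xchar_compose[OF assms]
  by (intro integrable_const_bound[where B = 1] AE_I2) (auto simp: norm_Xchar simp del: space_X_M)

lemma norm_charf_distr:
  assumes "\<xi> \<in> measurable M X_M"
  shows "cmod (charf (distr M X_M \<xi>) r h) \<le> 1"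
proof -
  have "cmod (LINT w|M. Xchar r h (\<xi> w)) \<le> (LINT w|M. cmod (Xchar r h (\<xi> w)))"
    by (rule integral_norm_bound)
  also have "\<dots> = (LINT w|M. 1)"
    using measurable_space[OF assms] by (intro Bochner_Integration.integral_cong) (auto simp: norm_Xchar simp del: space_X_M)
  finally show ?thesis by (simp add: charf_distr[OF assms] prob_space)
qed

lemma AE_Xchar_eq_charf:
  assumes "\<xi> \<in> measurable M X_M" "cmod (charf (distr M X_M \<xi>) r h) = 1"
  shows "AE w in M. Xchar r h (\<xi> w) = charf (distr M X_M \<xi>) r h"
  using AE_eq_expectation[of "\<lambda>w. Xchar r h (\<xi> w)"] assms measurable_space[OF assms(1)]
    measurable_Xchar_compose[OF assms(1)]
  by (simp add: charf_distr[OF assms(1)] norm_Xchar del: space_X_M)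

text \<open>A character whose mean has modulus one is almost surely constant and can be taken out of
  the integral; this is how moduli one turn into invariance.\<close>

lemma charf_distr_add:
  assumes \<xi>: "\<xi> \<in> measurable M X_M" and one: "cmod (charf (distr M X_M \<xi>) s k) = 1"
  shows "charf (distr M X_M \<xi>) (r + s) (h + k) = charf (distr M X_M \<xi>) r h * charf (distr M X_M \<xi>) s k"
proof -
  have "(LINT w|M. Xchar (r + s) (h + k) (\<xi> w)) = (LINT w|M. Xchar r h (\<xi> w) * charf (distr M X_M \<xi>) s k)"
  proof (rule integral_cong_AE)
    show "AE w in M. Xchar (r + s) (h + k) (\<xi> w) = Xchar r h (\<xi> w) * charf (distr M X_M \<xi>) s k"
      using AE_Xchar_eq_charf[OF \<xi> one] AE_space
      by eventually_elim (simp add: Xchar_add[OF measurable_space[OF \<xi>]])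
  qed (use measurable_Xchar_compose[OF \<xi>] in auto)
  then show ?thesis by (simp add: charf_distr[OF \<xi>])
qed

end

locale heyde_pair = prob_space P for P :: "'o measure" +
  fixes \<xi>1 \<xi>2 :: "'o \<Rightarrow> (rat \<Rightarrow> complex) \<times> ('g::{ab_group_add, finite})"
    and a :: rat and \<alpha> :: "'g \<Rightarrow> 'g"
  assumes no_order_two: "\<And>g::'g. g + g = 0 \<Longrightarrow> g = 0"
    and a_nonzero: "a \<noteq> 0"
    and \<alpha>_bij: "bij \<alpha>" and \<alpha>_add: "\<And>x y. \<alpha> (x + y) = \<alpha> x + \<alpha> y"
    and meas1: "\<xi>1 \<in> measurable P X_M" and meas2: "\<xi>2 \<in> measurable P X_M"
    and indep: "indep_var X_M \<xi>1 X_M \<xi>2"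
    and nz1: "\<And>r h. charf (distr P X_M \<xi>1) r h \<noteq> 0"
    and nz2: "\<And>r h. charf (distr P X_M \<xi>2) r h \<noteq> 0"
    and symmetric: "distr P (X_M \<Otimes>\<^sub>M X_M)
           (\<lambda>w. (xadd (\<xi>1 w) (\<xi>2 w), xadd (\<xi>1 w) (alpha_aut a \<alpha> (\<xi>2 w)))) =
         distr P (X_M \<Otimes>\<^sub>M X_M)
           (\<lambda>w. (xadd (\<xi>1 w) (\<xi>2 w), xneg (xadd (\<xi>1 w) (alpha_aut a \<alpha> (\<xi>2 w)))))"
begin

definition f1 where "f1 = charf (distr P X_M \<xi>1)"
definition f2 where "f2 = charf (distr P X_M \<xi>2)"
definition b where "b = gadj \<alpha>"

lemma b_add: "b (h + k) = b h + b k"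
  unfolding b_def by (rule gadj_add[OF \<alpha>_add])

lemma b_zero: "b 0 = 0"
  using b_add[of 0 0] by simp

lemma b_uminus: "b (- h) = - b h"
  using b_add[of h "- h"] b_zero by (simp add: add_eq_0_iff)

lemma gval_b: "gval (b h) g = gval h (\<alpha> g)"
  unfolding b_def by (rule gval_gadj[OF \<alpha>_add])

lemma b_inj: "inj b"
  unfolding b_def using \<alpha>_bij by (intro gadj_inj[OF \<alpha>_add]) (simp add: bij_def)

lemma double_inj: "inj (\<lambda>h::'g gchar. h + h)"
  by (rule gchar_double_inj) (rule no_order_two)

lemma double_bij: "bij (\<lambda>h::'g gchar. h + h)"
  using double_inj by (simp add: bij_def finite_UNIV_inj_surj)

lemma indep_product:
  "(LINT w|P. Xchar r h (\<xi>1 w) * Xchar s k (\<xi>2 w)) = f1 r h * f2 s k"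
proof -
  have "indep_var borel (Xchar r h \<circ> \<xi>1) borel (Xchar s k \<circ> \<xi>2)"
    by (rule indep_var_compose[OF indep measurable_Xchar measurable_Xchar])
  from indep_var_lebesgue_integral[OF this]
  show ?thesis
    using integrable_Xchar_compose[OF meas1] integrable_Xchar_compose[OF meas2]
    by (simp add: f1_def f2_def charf_distr[OF meas1] charf_distr[OF meas2] comp_def)
qed

text \<open>The joint characteristic functions of \<open>(L1, L2)\<close> and
  \<open>(L1, - L2)\<close> agree at every pair \<open>(r, h), (s, k)\<close>; collecting the
  characters of \<open>\<xi>1\<close> and those of \<open>\<xi>2\<close> and using independence
  splits each into two factors.\<close>

lemma heyde_equation:
  "f1 (r + s) (h + k) * f2 (r + a * s) (h + b k) = f1 (r - s) (h - k) * f2 (r - a * s) (h - b k)"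
proof -
  let ?L1 = "\<lambda>w. xadd (\<xi>1 w) (\<xi>2 w)" and ?L2 = "\<lambda>w. xadd (\<xi>1 w) (alpha_aut a \<alpha> (\<xi>2 w))"
  have L1: "?L1 \<in> measurable P X_M" by (rule measurable_xadd_pair[OF meas1 meas2])
  have L2: "?L2 \<in> measurable P X_M"
    by (rule measurable_xadd_pair[OF meas1 measurable_compose[OF meas2 measurable_alpha_aut]])
  have L2': "(\<lambda>w. xneg (?L2 w)) \<in> measurable P X_M" by (rule measurable_compose[OF L2 measurable_xneg])
  have "(LINT w|P. Xchar r h (?L1 w) * Xchar s k (?L2 w)) =
        (LINT w|P. Xchar r h (?L1 w) * Xchar s k (xneg (?L2 w)))"
    using pair_distr_LINT_eq[OF symmetric measurable_Pair[OF L1 L2] measurable_Pair[OF L1 L2'], of r h s k] by simp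
  also have "(LINT w|P. Xchar r h (?L1 w) * Xchar s k (?L2 w)) =
      (LINT w|P. Xchar (r + s) (h + k) (\<xi>1 w) * Xchar (r + a * s) (h + b k) (\<xi>2 w))"
    by (intro Bochner_Integration.integral_cong refl)
      (simp add: Xchar_xadd Xchar_alpha_aut[OF \<alpha>_add] b_def mult_ac
        Xchar_add[OF measurable_space[OF meas1]] Xchar_add[OF measurable_space[OF meas2]])
  also have "(LINT w|P. Xchar r h (?L1 w) * Xchar s k (xneg (?L2 w))) =
      (LINT w|P. Xchar (r + - s) (h + - k) (\<xi>1 w) * Xchar (r + - (a * s)) (h + - b k) (\<xi>2 w))"
    by (intro Bochner_Integration.integral_cong refl)
      (simp add: Xchar_xadd Xchar_xneg Xchar_alpha_aut[OF \<alpha>_add] b_uminus[unfolded b_def] b_def mult_ac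
        Xchar_add[OF measurable_space[OF meas1]] Xchar_add[OF measurable_space[OF meas2]]
        del: add_uminus_conv_diff)
  finally show ?thesis unfolding indep_product by simp
qed

lemma f_zero: "f1 0 0 = 1" "f2 0 0 = 1"
  unfolding f1_def f2_def by (rule charf_distr_zero[OF meas1], rule charf_distr_zero[OF meas2])

lemma f_nonzero: "f1 r h \<noteq> 0" "f2 r h \<noteq> 0"
  unfolding f1_def f2_def by (rule nz1, rule nz2)

lemma f_uminus: "f1 (- r) (- h) = cnj (f1 r h)" "f2 (- r) (- h) = cnj (f2 r h)"
  unfolding f1_def f2_def by (rule charf_distr_uminus[OF meas1], rule charf_distr_uminus[OF meas2])

lemma f_uminus_0: "f1 0 (- h) = cnj (f1 0 h)" "f2 0 (- h) = cnj (f2 0 h)"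
  using f_uminus[of 0 h] by simp_all

lemma f_norm: "cmod (f1 r h) \<le> 1" "cmod (f2 r h) \<le> 1"
  unfolding f1_def f2_def by (rule norm_charf_distr[OF meas1], rule norm_charf_distr[OF meas2])

lemma moduli_one:
  "cmod (f1 0 (h + b h)) = 1" "cmod (f2 0 (h + b h)) = 1"
proof -
  interpret m: heyde_moduli "\<lambda>h. cmod (f1 0 h)" "\<lambda>h. cmod (f2 0 h)" b
  proof
    fix u
    have "f1 0 (u + u) * f2 0 (u + b u) = f2 0 (u - b u)"
      using heyde_equation[of 0 0 u u] by (simp add: f_zero)
    then show "cmod (f1 0 (u + u)) * cmod (f2 0 (u + b u)) = cmod (f2 0 (u - b u))"
      by (metis norm_mult)
    have "f2 0 (b u + b u) * f1 0 (u + b u) = f1 0 (- (u - b u))"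
      using heyde_equation[of 0 0 "b u" u] by (simp add: f_zero add.commute mult.commute)
    then show "cmod (f2 0 (b u + b u)) * cmod (f1 0 (u + b u)) = cmod (f1 0 (u - b u))"
      unfolding f_uminus_0 by (metis complex_mod_cnj norm_mult)
  qed (use f_nonzero f_norm b_add b_inj double_inj in auto)
  show "cmod (f1 0 (h + b h)) = 1" "cmod (f2 0 (h + b h)) = 1"
    by (rule m.moduli_one)+
qed

lemma f_add:
  "f1 r (h + (k + b k)) = f1 r h * f1 0 (k + b k)"
  "f2 r (h + (k + b k)) = f2 r h * f2 0 (k + b k)"
  using charf_distr_add[OF meas1, of 0 "k + b k" r h] charf_distr_add[OF meas2, of 0 "k + b k" r h]
    moduli_one[of k] by (simp_all add: f1_def f2_def)

section \<open>Shift to functions invariant under the image of I + b\<close>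

lemma AE_image: "AE w in P. \<forall>k. gval (k + b k) (snd (\<xi>2 w)) = f2 0 (k + b k)"
proof -
  have "AE w in P. \<forall>k\<in>UNIV. gval (k + b k) (snd (\<xi>2 w)) = f2 0 (k + b k)"
  \<comment> \<open>Finiteness of the dual leaves one exceptional null set for all
    \<open>k\<close>.\<close>
  proof (rule AE_finite_allI)
    fix k
    have "AE w in P. Xchar 0 (k + b k) (\<xi>2 w) = f2 0 (k + b k)"
      unfolding f2_def by (rule AE_Xchar_eq_charf[OF meas2 moduli_one(2)[of k, unfolded f2_def]])
    then show "AE w in P. gval (k + b k) (snd (\<xi>2 w)) = f2 0 (k + b k)"
      using AE_space
    proof eventually_elim
      case (elim w)
      then show ?case using measurable_space[OF meas2, of w] by (auto simp: Xchar_def sol_zero mem_Times_iff)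
    qed
  qed simp
  then show ?thesis by simp
qed

text \<open>Almost every value of \<open>snd \<xi>2\<close> qualifies by \<open>AE_image\<close>, so
  such a point exists in a probability space.\<close>

definition g2 :: 'g where "g2 = (SOME g. \<forall>k. gval (k + b k) g = f2 0 (k + b k))"

lemma gval_g2: "gval (k + b k) g2 = f2 0 (k + b k)"
proof -
  have "\<exists>w. \<forall>k. gval (k + b k) (snd (\<xi>2 w)) = f2 0 (k + b k)"
  proof (rule ccontr)
    assume none: "\<nexists>w. \<forall>k. gval (k + b k) (snd (\<xi>2 w)) = f2 0 (k + b k)"
    have "AE w in P. False" using AE_image by eventually_elim (use none in blast)
    then show False by simp
  qed
  then have "\<exists>g. \<forall>k. gval (k + b k) g = f2 0 (k + b k)" by blast
  then show ?thesis unfolding g2_def by (rule someI2_ex) blast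
qed

text \<open>The two shifts satisfy \<open>g1 + \<alpha> g2 = 0\<close>, so that shifting by them preserves the functional equation.\<close>

definition g1 :: 'g where "g1 = - \<alpha> g2"

lemma gval_g1: "gval k g1 = cnj (gval (b k) g2)"
  by (simp add: g1_def gval_uminus_right gval_b)

text \<open>\<open>f1 0 m * f2 0 (b m)\<close> is real by the equation at \<open>h = 0\<close> and
  has modulus one, so only its sign is open. Squaring removes the sign: both functions are
  multiplicative on \<open>(I + b) H\<close>, so the identity holds at \<open>m + m\<close>, and
  doubling is surjective.\<close>

lemma gval_g1_image: "gval (k + b k) g1 = f1 0 (k + b k)"
proof -
  obtain l where k: "k = l + l" using double_bij unfolding bij_def surj_def by blast
  define m where "m = l + b l"
  have m2: "k + b k = m + m" by (simp add: k m_def b_add add_ac)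
  have bm: "b m = b l + b (b l)" by (simp add: m_def b_add)
  define X where "X = f1 0 m * f2 0 (b m)"
  have one: "cmod X = 1"
    using moduli_one[of l] moduli_one[of "b l"] by (simp add: X_def norm_mult m_def bm b_add)
  have "X = cnj X"
    using heyde_equation[of 0 0 0 m] by (simp add: X_def f_uminus_0)
  then have XX: "X * X = 1"
    using one by (metis complex_norm_square of_real_1 power_one)
  have "f1 0 (m + m) = f1 0 m * f1 0 m"
    using f_add(1)[of 0 m l] by (simp add: m_def)
  moreover have "f2 0 (b (m + m)) = f2 0 (b m) * f2 0 (b m)"
    using f_add(2)[of 0 "b m" "b l"] by (simp add: bm b_add)
  moreover have "f2 0 (b (m + m)) = gval (b (m + m)) g2"
    using gval_g2[of "b k"] by (simp add: m2[symmetric] b_add)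
  ultimately have "f1 0 (m + m) * gval (b (m + m)) g2 = 1"
    using XX by (simp add: X_def mult_ac)
  moreover have "cnj (gval (b (m + m)) g2) * gval (b (m + m)) g2 = 1"
    by (metis gval_mult_cnj mult.commute)
  ultimately have "f1 0 (m + m) = gval (m + m) g1"
    unfolding gval_g1 by (metis gval_nonzero mult_right_cancel)
  then show ?thesis by (simp add: m2)
qed

text \<open>The characteristic functions after translating the \<open>G\<close>-components by
  \<open>- g1\<close> and \<open>- g2\<close>.\<close>

definition F1 where "F1 r h = f1 r h * cnj (gval h g1)"
definition F2 where "F2 r h = f2 r h * cnj (gval h g2)"

lemma f_eq_F: "f1 r h = F1 r h * gval h g1" "f2 r h = F2 r h * gval h g2"
  using gval_mult_cnj[of h g1] gval_mult_cnj[of h g2]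
  by (simp_all add: F1_def F2_def mult.assoc mult.commute[of "cnj _"])

lemma F_invariant: "F1 r (h + (k + b k)) = F1 r h" "F2 r (h + (k + b k)) = F2 r h"
proof -
  have "F1 r (h + (k + b k)) = F1 r h * (gval (k + b k) g1 * cnj (gval (k + b k) g1))"
    unfolding F1_def f_add gval_add[of h] gval_g1_image by simp
  then show "F1 r (h + (k + b k)) = F1 r h" unfolding gval_mult_cnj by simp
  have "F2 r (h + (k + b k)) = F2 r h * (gval (k + b k) g2 * cnj (gval (k + b k) g2))"
    unfolding F2_def f_add gval_add[of h] gval_g2 by simp
  then show "F2 r (h + (k + b k)) = F2 r h" unfolding gval_mult_cnj by simp
qed

lemma F_nonzero: "F1 r h \<noteq> 0" "F2 r h \<noteq> 0"
  by (simp_all add: F1_def F2_def f_nonzero)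

lemma F_zero: "F1 0 0 = 1" "F2 0 0 = 1"
  by (simp_all add: F1_def F2_def f_zero)

text \<open>\<open>gval k g1\<close> and \<open>gval (b k) g2\<close> are inverse to each other, so
  both sides of the equation for \<open>f1\<close> and \<open>f2\<close> are multiplied by the same
  number.\<close>

lemma F_equation:
  "F1 (r + s) (h + k) * F2 (r + a * s) (h + b k) = F1 (r - s) (h - k) * F2 (r - a * s) (h - b k)"
proof -
  have "gval (h + k) g1 * gval (h + b k) g2 = gval h g1 * gval h g2 * (gval (b k) g2 * cnj (gval (b k) g2))" for k
    unfolding gval_add gval_g1[of k] by simp
  then have e: "gval (h + k) g1 * gval (h + b k) g2 = gval h g1 * gval h g2" for k
    unfolding gval_mult_cnj by simp
  have "gval (h - k) g1 * gval (h - b k) g2 = gval h g1 * gval h g2"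
    using e[of "- k"] by (simp add: b_uminus)
  then have "cnj (gval (h + k) g1) * cnj (gval (h + b k) g2) = cnj (gval (h - k) g1) * cnj (gval (h - b k) g2)"
    using e[of k] by (metis complex_cnj_mult)
  then have "f1 (r + s) (h + k) * f2 (r + a * s) (h + b k) * (cnj (gval (h + k) g1) * cnj (gval (h + b k) g2))
     = f1 (r - s) (h - k) * f2 (r - a * s) (h - b k) * (cnj (gval (h - k) g1) * cnj (gval (h - b k) g2))"
    unfolding heyde_equation by simp
  then show ?thesis by (simp only: F1_def F2_def mult_ac)
qed

lemma F_separated: "F1 (r + s) p * F2 (r + a * s) q = F1 (r - s) q * F2 (r - a * s) p"
  by (rule heyde_invariant_separated[OF F_equation F_invariant(2) double_bij])

section \<open>Gaussian factors and the factor on the kernel\<close>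

lemma gaussian_form:
  assumes "a \<noteq> -1"
  shows "\<exists>z\<in>sol. \<exists>\<sigma>\<ge>0. \<forall>r. f1 r 0 = z r * exp (complex_of_real (- \<sigma> * (real_of_rat r)\<^sup>2))"
    and "\<exists>z\<in>sol. \<exists>\<sigma>\<ge>0. \<forall>r. f2 r 0 = z r * exp (complex_of_real (- \<sigma> * (real_of_rat r)\<^sup>2))"
proof -
  have eq: "f1 (u + v) 0 * f2 (u + a * v) 0 = f1 (u - v) 0 * f2 (u - a * v) 0" for u v
    using heyde_equation[of u v 0 0] by (simp add: b_zero)
  have sym: "f1 (- r) 0 = cnj (f1 r 0)" "f2 (- r) 0 = cnj (f2 r 0)" for r
    using f_uminus[of r 0] by simp_all
  have "(\<exists>z\<in>sol. \<exists>\<sigma>\<ge>0. \<forall>r. f1 r 0 = z r * exp (complex_of_real (- \<sigma> * (real_of_rat r)\<^sup>2))) \<and>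
    (\<exists>z\<in>sol. \<exists>\<sigma>\<ge>0. \<forall>r. f2 r 0 = z r * exp (complex_of_real (- \<sigma> * (real_of_rat r)\<^sup>2)))"
  \<comment> \<open>The second-difference argument divides by \<open>1 - a\<close>. For
    \<open>a = 1\<close> the equation gives \<open>f1 r 0 * f2 r 0 = 1\<close> instead, which forces
    moduli one, hence characters and \<open>\<sigma> = 0\<close>.\<close>
  proof (cases "a = 1")
    case True
    have one: "cmod (f1 r 0) = 1 \<and> cmod (f2 r 0) = 1" for r
    proof -
      have "f1 r 0 * f2 r 0 = 1" using eq[of "r / 2" "r / 2"] True by (simp add: f_zero)
      then have "cmod (f1 r 0) * cmod (f2 r 0) = 1" by (metis norm_mult norm_one)
      then show ?thesis using f_norm[of r 0] mult_left_le[of "cmod (f2 r 0)" "cmod (f1 r 0)"]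
          mult_left_le[of "cmod (f1 r 0)" "cmod (f2 r 0)"] by (simp add: mult.commute)
    qed
    have "(\<lambda>r. f1 r 0) \<in> sol" "(\<lambda>r. f2 r 0) \<in> sol"
      using one charf_distr_add[OF meas1, of _ 0 _ 0] charf_distr_add[OF meas2, of _ 0 _ 0]
      unfolding sol_def f1_def f2_def by simp_all
    then show ?thesis
      by (intro conjI bexI[of _ "\<lambda>r. f1 r 0"] bexI[of _ "\<lambda>r. f2 r 0"] exI[of _ 0]) auto
  next
    case False
    \<comment> \<open>Replacing \<open>v\<close> by \<open>v / a\<close> exchanges the two functions
      and turns \<open>a\<close> into \<open>1 / a\<close>, which again avoids 0, 1 and -1.\<close>
    have eq': "f2 (u + v) 0 * f1 (u + (1 / a) * v) 0 = f2 (u - v) 0 * f1 (u - (1 / a) * v) 0" for u v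
      using eq[of u "v / a"] a_nonzero by (simp add: mult.commute)
    have a': "1 / a \<noteq> 0" "1 / a \<noteq> 1" "1 / a \<noteq> -1"
      using a_nonzero False assms by (simp_all add: divide_eq_eq)
    show ?thesis
      using heyde_gaussian_form[of "\<lambda>r. f1 r 0" "\<lambda>r. f2 r 0", OF f_nonzero eq a_nonzero False assms f_zero(1) sym(1) f_norm(1)]
        heyde_gaussian_form[of "\<lambda>r. f2 r 0" "\<lambda>r. f1 r 0", OF f_nonzero(2,1) eq' a' f_zero(2) sym(2) f_norm(2)]
      unfolding sol_def by blast
  qed
  then show "\<exists>z\<in>sol. \<exists>\<sigma>\<ge>0. \<forall>r. f1 r 0 = z r * exp (complex_of_real (- \<sigma> * (real_of_rat r)\<^sup>2))"
    and "\<exists>z\<in>sol. \<exists>\<sigma>\<ge>0. \<forall>r. f2 r 0 = z r * exp (complex_of_real (- \<sigma> * (real_of_rat r)\<^sup>2))"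
    by blast+
qed

text \<open>\<open>gval k (x + \<alpha> x)\<close> equals \<open>gval (k + b k) x\<close>, which is
  1 at the shifted value for every \<open>k\<close>; characters separate points.\<close>

lemma AE_kernel: "AE w in P. (snd (\<xi>2 w) - g2) + \<alpha> (snd (\<xi>2 w) - g2) = 0"
  using AE_image
proof eventually_elim
  case (elim w)
  let ?x = "snd (\<xi>2 w) - g2"
  have "gval k (?x + \<alpha> ?x) = 1" for k
  proof -
    have "gval k (?x + \<alpha> ?x) = gval (k + b k) ?x" by (simp only: gval_add_right gval_add gval_b)
    also have "\<dots> = gval (k + b k) (snd (\<xi>2 w)) * cnj (gval (k + b k) g2)"
      by (metis diff_conv_add_uminus gval_add_right gval_uminus_right)
    also have "\<dots> = 1" using elim gval_mult_cnj[of "k + b k" g2] by (simp add: gval_g2)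
    finally show ?thesis .
  qed
  then show ?case using gchar_separates by blast
qed

lemma measurable_shift:
  assumes "\<And>w. w \<in> space P \<Longrightarrow> c w \<in> sol" "\<And>r. (\<lambda>w. c w r) \<in> borel_measurable P"
  shows "(\<lambda>w. (c w, snd (\<xi>2 w) - g2)) \<in> measurable P X_M"
  by (rule measurable_X_MI)
    (use assms measurable_compose[OF measurable_compose[OF meas2 measurable_X_snd], of "\<lambda>g. g - g2"] in auto)

lemma charf_shift:
  assumes "(\<lambda>w. (c w, snd (\<xi>2 w) - g2)) \<in> measurable P X_M"
  shows "charf (distr P X_M (\<lambda>w. (c w, snd (\<xi>2 w) - g2))) r h =
    (LINT w|P. c w r * gval h (snd (\<xi>2 w))) * cnj (gval h g2)"
proof -
  have "charf (distr P X_M (\<lambda>w. (c w, snd (\<xi>2 w) - g2))) r h =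
      (LINT w|P. (c w r * gval h (snd (\<xi>2 w))) * cnj (gval h g2))"
    unfolding charf_distr[OF assms] Xchar_def
    by (simp only: fst_conv snd_conv diff_conv_add_uminus gval_add_right gval_uminus_right mult.assoc)
  then show ?thesis by simp
qed

lemma sets_X_kernel: "{x \<in> space X_M. snd x + \<alpha> (snd x) = 0} \<in> sets X_M"
proof -
  have "{x \<in> space X_M. snd x + \<alpha> (snd x) = 0} = snd -` {g. g + \<alpha> g = 0} \<inter> space X_M" by auto
  then show ?thesis using measurable_sets[OF measurable_X_snd, of "{g. g + \<alpha> g = 0}"] by simp
qed

text \<open>A countable intersection, since the coordinates are indexed by rationals.\<close>

lemma sets_X_fst_one: "{x \<in> space (X_M :: ((rat \<Rightarrow> complex) \<times> 'g) measure). fst x = (\<lambda>r. 1)} \<in> sets X_M"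
proof -
  let ?X = "X_M :: ((rat \<Rightarrow> complex) \<times> 'g) measure"
  have "{x \<in> space ?X. fst x r = 1} = (\<lambda>x. fst x r) -` {1} \<inter> space ?X" for r by auto
  then have "{x \<in> space ?X. fst x r = 1} \<in> sets ?X" for r
    using measurable_sets[OF measurable_X_fst_component, of "{1}" r] by simp
  then have "{x \<in> space ?X. \<forall>r. fst x r = 1} \<in> sets ?X"
    by (rule sets.sets_Collect_countable_All)
  then show ?thesis by (simp add: fun_eq_iff)
qed

lemma AE_shift_kernel:
  assumes m: "(\<lambda>w. (c w, snd (\<xi>2 w) - g2)) \<in> measurable P X_M"
  shows "AE x in distr P X_M (\<lambda>w. (c w, snd (\<xi>2 w) - g2)). snd x + \<alpha> (snd x) = 0"
  using AE_kernel by (subst AE_distr_iff[OF m sets_X_kernel]) simp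

text \<open>Realises the common factor of the two separated functions: the
  \<open>G\<close>-component of the shifted \<open>\<xi>2\<close>, with the solenoid component
  replaced by the identity.\<close>

lemma marginal_shift:
  "\<exists>\<omega>. prob_space \<omega> \<and> sets \<omega> = sets X_M \<and>
    (AE x in \<omega>. fst x = (\<lambda>r. 1) \<and> snd x + \<alpha> (snd x) = 0) \<and> (\<forall>r h. charf \<omega> r h = F2 0 h)"
proof -
  let ?\<omega> = "distr P X_M (\<lambda>w. (\<lambda>r. 1, snd (\<xi>2 w) - g2))"
  have m: "(\<lambda>w. (\<lambda>r. 1, snd (\<xi>2 w) - g2)) \<in> measurable P X_M"
    by (rule measurable_shift) (simp_all add: sol_one)
  have "AE x in ?\<omega>. fst x = (\<lambda>r. 1)"
    by (subst AE_distr_iff[OF m sets_X_fst_one]) simp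
  moreover have "charf ?\<omega> r h = F2 0 h" for r h
  proof -
    have "(LINT w|P. 1 * gval h (snd (\<xi>2 w))) = (LINT w|P. Xchar 0 h (\<xi>2 w))"
      using measurable_space[OF meas2] by (intro Bochner_Integration.integral_cong) (auto simp: Xchar_def sol_zero mem_Times_iff)
    then show ?thesis unfolding charf_shift[OF m] by (simp add: F2_def f2_def charf_distr[OF meas2])
  qed
  ultimately show ?thesis using AE_shift_kernel[OF m] prob_space_distr[OF m]
    by (intro exI[of _ ?\<omega>]) auto
qed

text \<open>For \<open>a = -1\<close> the shifted functions coincide, so the shifted
  \<open>\<xi>2\<close> itself supplies the common distribution.\<close>

lemma joint_shift:
  "\<exists>\<omega>. prob_space \<omega> \<and> sets \<omega> = sets X_M \<and>
    (AE x in \<omega>. snd x + \<alpha> (snd x) = 0) \<and> (\<forall>r h. charf \<omega> r h = F2 r h)"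
proof -
  let ?\<omega> = "distr P X_M (\<lambda>w. (fst (\<xi>2 w), snd (\<xi>2 w) - g2))"
  have m: "(\<lambda>w. (fst (\<xi>2 w), snd (\<xi>2 w) - g2)) \<in> measurable P X_M"
    using measurable_space[OF meas2] measurable_compose[OF meas2 measurable_X_fst_component]
    by (intro measurable_shift) (auto simp: mem_Times_iff)
  have "charf ?\<omega> r h = F2 r h" for r h
    unfolding charf_shift[OF m] by (simp add: F2_def f2_def charf_distr[OF meas2] Xchar_def)
  then show ?thesis using AE_shift_kernel[OF m] prob_space_distr[OF m]
    by (intro exI[of _ ?\<omega>]) auto
qed

text \<open>\<open>z r * gval h g\<close> is the value of the character \<open>(r, h)\<close> at the
  point \<open>(z, g)\<close>, so it belongs to a point mass; what remains is a centred Gaussian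
  convolved with \<open>\<omega>\<close>.\<close>

lemma gaussian_factor:
  assumes \<xi>: "\<xi> \<in> measurable P X_M" and z: "z \<in> sol" and \<sigma>: "\<sigma> \<ge> 0"
    and \<omega>: "prob_space \<omega>" "sets \<omega> = sets X_M" "\<And>r h. charf \<omega> r h = F2 0 h"
    and form: "\<And>r h. charf (distr P X_M \<xi>) r h =
      z r * exp (complex_of_real (- \<sigma> * (real_of_rat r)\<^sup>2)) * F2 0 h * gval h g"
  shows "\<exists>\<gamma> x. gaussian_sol \<gamma> \<and> x \<in> space X_M \<and>
    distr P X_M \<xi> = conv_X (conv_X (embed_sol \<gamma>) \<omega>) (return X_M x)"
proof -
  obtain \<gamma> where \<gamma>: "gaussian_sol \<gamma>"
    "\<And>r. charfun_sol \<gamma> r = exp (complex_of_real (- \<sigma> * (real_of_rat r)\<^sup>2))"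
    using ex_gaussian_sol[OF \<sigma>] by blast
  then have \<gamma>': "prob_space \<gamma>" "sets \<gamma> = sets sol_M" unfolding gaussian_sol_def by auto
  note e = prob_space_embed_sol[OF \<gamma>', where 'g = 'g] sets_embed_sol[OF \<gamma>', where 'g = 'g]
  note c = prob_space_conv_X[OF e \<omega>(1,2)] sets_conv_X[OF e \<omega>(1,2)]
  have x: "(z, g) \<in> space X_M" using z by simp
  have r: "prob_space (return X_M (z, g))" "sets (return X_M (z, g)) = sets X_M"
    using prob_space_return[OF x] by auto
  have "distr P X_M \<xi> = conv_X (conv_X (embed_sol \<gamma>) \<omega>) (return X_M (z, g))"
    by (rule X_measure_eqI[OF prob_space_distr[OF \<xi>] sets_distr prob_space_conv_X[OF c r] sets_conv_X[OF c r]])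
      (simp add: charf_conv_X[OF c r] charf_conv_X[OF e \<omega>(1,2)] charf_return[OF x] charf_embed_sol[OF \<gamma>']
        \<gamma>(2) \<omega>(3) form Xchar_def mult_ac)
  then show ?thesis using \<gamma>(1) x by blast
qed

lemma heyde_not_minus_one:
  assumes "a \<noteq> -1"
  shows "\<exists>\<gamma>1 \<gamma>2 \<omega> x1 x2. gaussian_sol \<gamma>1 \<and> gaussian_sol \<gamma>2 \<and>
    prob_space \<omega> \<and> sets \<omega> = sets X_M \<and>
    (AE x in \<omega>. fst x = (\<lambda>r. 1) \<and> snd x + \<alpha> (snd x) = 0) \<and>
    x1 \<in> space X_M \<and> x2 \<in> space X_M \<and>
    distr P X_M \<xi>1 = conv_X (conv_X (embed_sol \<gamma>1) \<omega>) (return X_M x1) \<and>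
    distr P X_M \<xi>2 = conv_X (conv_X (embed_sol \<gamma>2) \<omega>) (return X_M x2)"
proof -
  obtain \<omega> where \<omega>: "prob_space \<omega>" "sets \<omega> = sets X_M"
    "AE x in \<omega>. fst x = (\<lambda>r. 1) \<and> snd x + \<alpha> (snd x) = 0" "\<And>r h. charf \<omega> r h = F2 0 h"
    using marginal_shift by blast
  note split = heyde_separated_split[of F1 F2 a, OF F_separated F_nonzero F_zero assms]
  obtain z1 \<sigma>1 where 1: "z1 \<in> sol" "\<sigma>1 \<ge> 0"
    "\<And>r. f1 r 0 = z1 r * exp (complex_of_real (- \<sigma>1 * (real_of_rat r)\<^sup>2))"
    using gaussian_form(1)[OF assms] by blast
  obtain z2 \<sigma>2 where 2: "z2 \<in> sol" "\<sigma>2 \<ge> 0"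
    "\<And>r. f2 r 0 = z2 r * exp (complex_of_real (- \<sigma>2 * (real_of_rat r)\<^sup>2))"
    using gaussian_form(2)[OF assms] by blast
  have F0: "F1 r 0 = f1 r 0" "F2 r 0 = f2 r 0" for r by (simp_all add: F1_def F2_def)
  have "charf (distr P X_M \<xi>1) r h = z1 r * exp (complex_of_real (- \<sigma>1 * (real_of_rat r)\<^sup>2)) * F2 0 h * gval h g1" for r h
    using f_eq_F(1)[of r h] unfolding split(1)[of r h] F0 1(3) by (simp only: f1_def)
  note G1 = gaussian_factor[OF meas1 1(1,2) \<omega>(1,2,4) this]
  have "charf (distr P X_M \<xi>2) r h = z2 r * exp (complex_of_real (- \<sigma>2 * (real_of_rat r)\<^sup>2)) * F2 0 h * gval h g2" for r h
    using f_eq_F(2)[of r h] unfolding split(2)[of r h] F0 2(3) by (simp only: f2_def)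
  note G2 = gaussian_factor[OF meas2 2(1,2) \<omega>(1,2,4) this]
  show ?thesis using G1 G2 \<omega>(1-3) by blast
qed

lemma shift_factor:
  fixes \<xi> :: "'o \<Rightarrow> (rat \<Rightarrow> complex) \<times> 'g"
  assumes \<xi>: "\<xi> \<in> measurable P X_M"
    and \<omega>: "prob_space \<omega>" "sets \<omega> = sets X_M"
    and form: "\<And>r h. charf (distr P X_M \<xi>) r h = charf \<omega> r h * gval h g"
  shows "\<exists>x. x \<in> space X_M \<and> distr P X_M \<xi> = conv_X \<omega> (return X_M x)"
proof -
  have x: "(\<lambda>r. 1, g) \<in> space X_M" using sol_one by simp
  have r: "prob_space (return X_M (\<lambda>r. 1, g))" "sets (return X_M (\<lambda>r. 1, g)) = sets X_M"
    using prob_space_return[OF x] by auto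
  have "distr P X_M \<xi> = conv_X \<omega> (return X_M (\<lambda>r. 1, g))"
    by (rule X_measure_eqI[OF prob_space_distr[OF \<xi>] sets_distr prob_space_conv_X[OF \<omega> r] sets_conv_X[OF \<omega> r]])
      (simp add: charf_conv_X[OF \<omega> r] charf_return[OF x] form Xchar_def)
  then show ?thesis using x by blast
qed

lemma heyde_minus_one:
  assumes "a = -1"
  shows "\<exists>\<omega> x1 x2. prob_space \<omega> \<and> sets \<omega> = sets X_M \<and>
    (AE x in \<omega>. snd x + \<alpha> (snd x) = 0) \<and>
    x1 \<in> space X_M \<and> x2 \<in> space X_M \<and>
    distr P X_M \<xi>1 = conv_X \<omega> (return X_M x1) \<and>
    distr P X_M \<xi>2 = conv_X \<omega> (return X_M x2)"
proof -
  obtain \<omega> where \<omega>: "prob_space \<omega>" "sets \<omega> = sets X_M"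
    "AE x in \<omega>. snd x + \<alpha> (snd x) = 0" "\<And>r h. charf \<omega> r h = F2 r h"
    using joint_shift by blast
  have "F1 (r + s) p * F2 (r - s) q = F1 (r - s) q * F2 (r + s) p" for r s p q
    using F_separated[of r s p q] assms by simp
  then have "F1 r h = F2 r h" for r h using F_zero by (rule heyde_separated_eq)
  note F = this
  have "charf (distr P X_M \<xi>1) r h = charf \<omega> r h * gval h g1" for r h
    using f_eq_F(1)[of r h] unfolding F \<omega>(4) by (simp only: f1_def)
  note G1 = shift_factor[OF meas1 \<omega>(1,2) this]
  have "charf (distr P X_M \<xi>2) r h = charf \<omega> r h * gval h g2" for r h
    using f_eq_F(2)[of r h] unfolding \<omega>(4) by (simp only: f2_def)
  note G2 = shift_factor[OF meas2 \<omega>(1,2) this]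
  show ?thesis using G1 G2 \<omega>(1-3) by blast
qed

end

theorem theorem4p1:
  fixes P :: "'o measure"
    and \<xi>1 \<xi>2 :: "'o \<Rightarrow> (rat \<Rightarrow> complex) \<times> ('g::{ab_group_add, finite})"
    and a :: rat and \<alpha>G :: "'g \<Rightarrow> 'g"
  assumes "prob_space P"
    and "\<forall>g::'g. g + g = 0 \<longrightarrow> g = 0"
    and "a \<noteq> 0"
    and "bij \<alpha>G" and "\<forall>x y. \<alpha>G (x + y) = \<alpha>G x + \<alpha>G y"
    and "\<xi>1 \<in> measurable P X_M" and "\<xi>2 \<in> measurable P X_M"
    and "prob_space.indep_var P X_M \<xi>1 X_M \<xi>2"
    and "\<forall>r \<psi>. g_char \<psi> \<longrightarrow> charfun_X (distr P X_M \<xi>1) r \<psi> \<noteq> 0"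
    and "\<forall>r \<psi>. g_char \<psi> \<longrightarrow> charfun_X (distr P X_M \<xi>2) r \<psi> \<noteq> 0"
    and "distr P (X_M \<Otimes>\<^sub>M X_M)
           (\<lambda>\<omega>. (xadd (\<xi>1 \<omega>) (\<xi>2 \<omega>), xadd (\<xi>1 \<omega>) (alpha_aut a \<alpha>G (\<xi>2 \<omega>)))) =
         distr P (X_M \<Otimes>\<^sub>M X_M)
           (\<lambda>\<omega>. (xadd (\<xi>1 \<omega>) (\<xi>2 \<omega>), xneg (xadd (\<xi>1 \<omega>) (alpha_aut a \<alpha>G (\<xi>2 \<omega>)))))"
  shows "(a \<noteq> -1 \<longrightarrow>
           (\<exists>\<gamma>1 \<gamma>2 \<omega> x1 x2. gaussian_sol \<gamma>1 \<and> gaussian_sol \<gamma>2 \<and>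
              prob_space \<omega> \<and> sets \<omega> = sets X_M \<and>
              (AE x in \<omega>. fst x = (\<lambda>r. 1) \<and> snd x + \<alpha>G (snd x) = 0) \<and>
              x1 \<in> space X_M \<and> x2 \<in> space X_M \<and>
              distr P X_M \<xi>1 = conv_X (conv_X (embed_sol \<gamma>1) \<omega>) (return X_M x1) \<and>
              distr P X_M \<xi>2 = conv_X (conv_X (embed_sol \<gamma>2) \<omega>) (return X_M x2)))
       \<and> (a = -1 \<longrightarrow>
           (\<exists>\<omega> x1 x2. prob_space \<omega> \<and> sets \<omega> = sets X_M \<and>
              (AE x in \<omega>. snd x + \<alpha>G (snd x) = 0) \<and>
              x1 \<in> space X_M \<and> x2 \<in> space X_M \<and>
              distr P X_M \<xi>1 = conv_X \<omega> (return X_M x1) \<and>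
              distr P X_M \<xi>2 = conv_X \<omega> (return X_M x2)))"

proof -
  have indep_P: "prob_space.indep_var P X_M \<xi>1 X_M \<xi>2" by fact
  interpret prob_space P by fact
  interpret heyde_pair P \<xi>1 \<xi>2 a \<alpha>G
  proof
    show "charf (distr P X_M \<xi>1) r h \<noteq> 0" "charf (distr P X_M \<xi>2) r h \<noteq> 0" for r h
      using assms(9,10) g_char_gval unfolding charf_def by blast+
  qed (use assms in blast)+
  show ?thesis using heyde_not_minus_one heyde_minus_one by blast
qed

end
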